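(* Let $\lambda\in R$ be such that $\Gamma(\lambda)$ is of Type B. Suppose that $\mathcal M_{loc,\lambda}$ is bounded from $L^p(\mathbb R^3)$ to $L^q(\mathbb R^3)$. Write $M=M^\lambda$, $x=\frac1p$, $y=\frac1q$. Then: (1) If $c\ne0$, then $\frac{m/2+1}{p}-\frac1q-1\le0$ and $\frac1q\le\frac1p\le\frac3q$. (2) If $c=0$, then $\frac{m/2+1}{p}-\frac{m/2+1}{q}-1\le0$. Moreover: (i) if $M\ge6$, then $(x,y)$ belongs to the closed quadrilateral bounded by the lines $x=\frac{M+1}{2M}$, $(\frac M2+1)x-(\frac M2+1)y-1=0$, $x=3y$ and the diagonal $x=y$, i.e. $y\le x\le3y$, $x\le\frac{M+1}{2M}$ and $(\frac M2+1)(x-y)\le1$; (ii) if $M=5$, then $(x,y)$ belongs to the closed pentagon bounded by the lines $x=\frac{M+1}{2M}$, $y=\frac{3M+2}{M+2}x-1$, $(\frac M2+1)x-(\frac M2+1)y-1=0$, $x=3y$ and the diagonal $x=y$, i.e. $y\le x\le3y$, $x\le\frac{M+1}{2M}$, $y\ge\frac{3M+2}{M+2}x-1$ and $(\frac M2+1)(x-y)\le1$; (iii) if $M=4$ or $M=3$, then $(x,y)$ belongs to the closed quadrilateral bounded by the lines $x=\frac{M+1}{2M}$, $y=\frac{3M+2}{M+2}x-1$, $x=3y$ and the diagonal $x=y$, i.e. $y\le x\le3y$, $x\le\frac{M+1}{2M}$ and $y\ge\frac{3M+2}{M+2}x-1$.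
   Context: Let $m\ge2$ be an integer, $c\in\mathbb R$, and let $\Phi\in\mathbb R[x_1,x_2]$ be a nonzero homogeneous polynomial of degree $m$. Standing assumption: $\Phi$ is not a constant multiple of the $m$-th power of a real linear form. Let $H\Phi=\partial_{11}\Phi\,\partial_{22}\Phi-(\partial_{12}\Phi)^2$ be the Hessian determinant. Write $H\Phi(x_1,x_2)=x_1^{\alpha_1}\prod_{\lambda\in R}(x_2-\lambda x_1)^{\omega_\lambda}Q(x_1,x_2)$, where $R\subset\mathbb R$ is the finite set of real $\lambda$ (possibly including $0$) with $H\Phi(1,\lambda)=0$, $\omega_\lambda\ge1$, and $Q\neq0$ away from the origin. For $\lambda\in R$ let $L_\lambda=\{x_2=\lambda x_1\}$. For a fixed sufficiently small $\epsilon>0$ and $\lambda\in R$, let $\Gamma(\lambda)\subset\mathbb R^2\setminus\{0\}$ be the set of $x$ whose angle with $(1,\lambda)$ or with $(-1,-\lambda)$ is $<\epsilon$ ($\epsilon$ so small that the sectors around the distinct lines in the zero set of $H\Phi$ are pairwise disjoint). $\Gamma(\lambda)$ is of Type B if $\Phi$ does not vanish along $L_\lambda\setminus\{(0,0)\}$. In that case $M^\lambda=\omega_\lambda+2\ge3$. (This is the smallest integer $k\ge2$ with $\Psi^{(k)}(0)\ne0$, where the level curve $\{\Phi=1\}$ near a point of $L_\lambda$ is written as $z_1=\Psi(z_2)$ in the coordinates $x_1=z_1,\ x_2=z_2+\lambda z_1$.) Let $U$ be a fixed sufficiently small neighborhood of the origin in $\mathbb R^2$, $S_\lambda=\{(x_1,x_2,\Phi(x_1,x_2)+c):(x_1,x_2)\in\Gamma(\lambda)\cap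 U\}$, $d\sigma_\lambda$ the surface measure on $S_\lambda$, and $$A_{t,\lambda}f(y)=\int_{S_\lambda}f(y-tx)\,d\sigma_\lambda(x),\qquad \mathcal M_{loc,\lambda}f(y)=\sup_{t\in[1,2]}|A_{t,\lambda}f(y)|,\quad y\in\mathbb R^3.$$ Boundedness from $L^p$ to $L^q$ means that $\|\mathcal M_{loc,\lambda}f\|_{L^q(\mathbb R^3)}\le C\|f\|_{L^p(\mathbb R^3)}$ for all $f$, with $C$ independent of $f$. *)

theory Defs
  imports "HOL-Analysis.Analysis"
begin

section \<open>Homogeneous polynomials in two variables and the Hessian determinant\<close>

definition homogeneous_poly :: "nat \<Rightarrow> (real^2 \<Rightarrow> real) \<Rightarrow> bool" where
  "homogeneous_poly d F \<longleftrightarrow>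
     (\<exists>a :: nat \<Rightarrow> real. \<forall>x. F x = (\<Sum>i\<le>d. a i * (x$1) ^ i * (x$2) ^ (d - i)))"

definition partial :: "2 \<Rightarrow> (real^2 \<Rightarrow> real) \<Rightarrow> real^2 \<Rightarrow> real" where
  "partial i F x = deriv (\<lambda>s. F (x + s *\<^sub>R axis i 1)) 0"

definition hessian_det :: "(real^2 \<Rightarrow> real) \<Rightarrow> real^2 \<Rightarrow> real" where
  "hessian_det F x =
     partial 1 (partial 1 F) x * partial 2 (partial 2 F) x - (partial 1 (partial 2 F) x)\<^sup>2"

text \<open>The factor \<open>Q\<close> is required to be a homogeneous polynomial, so \<open>\<alpha>\<close>, \<open>Q\<close> and the
  exponents \<open>\<omega> l\<close>, \<open>l \<in> R\<close>, are uniquely determined by \<open>F\<close>.\<close>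

definition hessian_factorization ::
  "(real^2 \<Rightarrow> real) \<Rightarrow> real set \<Rightarrow> nat \<Rightarrow> (real \<Rightarrow> nat) \<Rightarrow> (real^2 \<Rightarrow> real) \<Rightarrow> bool" where
  "hessian_factorization F R \<alpha> \<omega> Q \<longleftrightarrow>
     R = {l. hessian_det F (vector [1, l]) = 0} \<and> finite R \<and> (\<forall>l\<in>R. 1 \<le> \<omega> l) \<and>
     (\<exists>d. homogeneous_poly d Q) \<and> (\<forall>x. x \<noteq> 0 \<longrightarrow> Q x \<noteq> 0) \<and>
     (\<forall>x. hessian_det F x = (x$1) ^ \<alpha> * (\<Prod>l\<in>R. (x$2 - l * x$1) ^ \<omega> l) * Q x)"

section \<open>Sectors\<close>

definition vec_angle :: "real^2 \<Rightarrow> real^2 \<Rightarrow> real" where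
  "vec_angle u v = arccos (u \<bullet> v / (norm u * norm v))"

definition sector :: "real \<Rightarrow> real^2 \<Rightarrow> (real^2) set" where
  "sector \<epsilon> v = {x. x \<noteq> 0 \<and> (vec_angle x v < \<epsilon> \<or> vec_angle x (- v) < \<epsilon>)}"

definition Gamma_sector :: "real \<Rightarrow> real \<Rightarrow> (real^2) set" where
  "Gamma_sector \<epsilon> l = sector \<epsilon> (vector [1, l])"

text \<open>The zero set of the Hessian determinant is a union of lines through the origin; these are
  represented here by direction vectors, so the line \<open>x\<^sub>1 = 0\<close> is taken into account as well.\<close>

definition sectors_disjoint :: "(real^2 \<Rightarrow> real) \<Rightarrow> real \<Rightarrow> bool" where
  "sectors_disjoint F \<epsilon> \<longleftrightarrow>
     (\<forall>v w. v \<noteq> 0 \<longrightarrow> w \<noteq> 0 \<longrightarrow> hessian_det F v = 0 \<longrightarrow> hessian_det F w = 0 \<longrightarrow>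
        span {v} \<noteq> span {w} \<longrightarrow> sector \<epsilon> v \<inter> sector \<epsilon> w = {})"

definition L_line :: "real \<Rightarrow> (real^2) set" where
  "L_line l = {x. x$2 = l * x$1}"

definition type_B :: "(real^2 \<Rightarrow> real) \<Rightarrow> real \<Rightarrow> bool" where
  "type_B F l \<longleftrightarrow> (\<forall>x \<in> L_line l - {0}. F x \<noteq> 0)"

section \<open>Averages over the surface and the local maximal function\<close>

text \<open>Surface measure of the graph of \<open>g\<close> over \<open>D\<close>, i.e. the image of
  \<open>sqrt (1 + |grad g|^2) dx\<close> on \<open>D\<close> under the graph map, as a Borel measure on three-space
  that is concentrated on the graph.\<close>

definition graph_surface_measure :: "(real^2 \<Rightarrow> real) \<Rightarrow> (real^2) set \<Rightarrow> (real^3) measure" where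
  "graph_surface_measure g D =
     distr
       (density lborel
          (\<lambda>x. ennreal (sqrt (1 + (partial 1 g x)\<^sup>2 + (partial 2 g x)\<^sup>2)) * indicator D x))
       borel (\<lambda>x. vector [x$1, x$2, g x])"

definition sigma_measure ::
  "(real^2 \<Rightarrow> real) \<Rightarrow> real \<Rightarrow> real \<Rightarrow> (real^2) set \<Rightarrow> real \<Rightarrow> (real^3) measure" where
  "sigma_measure F c \<epsilon> U l = graph_surface_measure (\<lambda>x. F x + c) (Gamma_sector \<epsilon> l \<inter> U)"

definition average :: "(real^3) measure \<Rightarrow> real \<Rightarrow> (real^3 \<Rightarrow> complex) \<Rightarrow> real^3 \<Rightarrow> complex" where
  "average \<sigma> t f y = (\<integral>x. f (y - t *\<^sub>R x) \<partial>\<sigma>)"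

definition local_maximal :: "(real^3) measure \<Rightarrow> (real^3 \<Rightarrow> complex) \<Rightarrow> real^3 \<Rightarrow> ennreal" where
  "local_maximal \<sigma> f y = (SUP t\<in>{1..2}. ennreal (norm (average \<sigma> t f y)))"

section \<open>Lebesgue norms\<close>

definition epowr :: "ennreal \<Rightarrow> real \<Rightarrow> ennreal" where
  "epowr a r = (if a = \<infinity> then \<infinity> else ennreal (enn2real a powr r))"

text \<open>Norms are taken of \<open>[0,\<infinity>]\<close>-valued functions, because the maximal function may be
  infinite. The maximal function of a Borel function is Lebesgue measurable but not necessarily
  Borel; both clauses below give the same value for \<open>lborel\<close> and for its completion.
  Only exponents \<open>p \<ge> 1\<close> are used.\<close>

definition Lp_norm :: "ennreal \<Rightarrow> (real^3 \<Rightarrow> ennreal) \<Rightarrow> ennreal" where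
  "Lp_norm p g =
     (if p = \<infinity> then Inf {K. AE x in lborel. g x \<le> K}
      else epowr (\<integral>\<^sup>+x. epowr (g x) (enn2real p) \<partial>lborel) (1 / enn2real p))"

definition Lp_Lq_bounded ::
  "ennreal \<Rightarrow> ennreal \<Rightarrow> ((real^3 \<Rightarrow> complex) \<Rightarrow> real^3 \<Rightarrow> ennreal) \<Rightarrow> bool" where
  "Lp_Lq_bounded p q T \<longleftrightarrow>
     (\<exists>C::real. \<forall>f \<in> borel_measurable borel.
        Lp_norm p (\<lambda>x. ennreal (norm (f x))) < \<infinity> \<longrightarrow>
        Lp_norm q (T f) \<le> ennreal C * Lp_norm p (\<lambda>x. ennreal (norm (f x))))"

end

theory Submission
  imports Defs
begin

text \<open>
  Each necessary condition is obtained by testing the bound on the indicator function of one set \<open>F\<close>. If for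
  every point \<open>y\<close> of a set \<open>E\<close> some dilation \<open>t \<in> [1,2]\<close> carries a piece of the surface of area \<open>A\<close> into
  \<open>F\<close>, in the sense that \<open>y - t X \<in> F\<close> for the points \<open>X\<close> of the piece, then
  \<open>A |E|^(1/q) \<le> C |F|^(1/p)\<close>. With all three quantities powers of a scale \<open>\<rho> \<rightarrow> 0\<close>, this is a linear inequality
  between \<open>1/p\<close> and \<open>1/q\<close> (\<open>scaling_test\<close>). Six choices suffice.

  \<^item> Large cubes for both sets give \<open>1/q \<le> 1/p\<close> (\<open>test_large_cubes\<close>).
  \<^item> A \<open>\<rho>\<close>-neighbourhood of the reflected surface and a \<open>\<rho>\<close>-cube give \<open>1/p \<le> 3/q\<close>
    (\<open>test_surface_neighbourhood\<close>).
  \<^item> Over a \<open>\<rho>\<close>-square near the origin the surface is \<open>\<rho>^m\<close>-flat. For \<open>c \<noteq> 0\<close> dilations move this flat piece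
    by a fixed amount, for \<open>c = 0\<close> they do not; this gives the two conditions containing \<open>m\<close>
    (\<open>test_origin_box_translated\<close>, \<open>test_origin_box\<close>).
  \<^item> For \<open>c = 0\<close>, near the line \<open>x\<^sub>2 = l x\<^sub>1\<close> and away from the origin, the surface is within \<open>|x\<^sub>2 - l x\<^sub>1|^M\<close> of
    a cylinder over the curve \<open>w \<mapsto> \<phi> w^m\<close>, whose dilates fill an open set of the plane. A tube along the
    rulings gives \<open>1/p \<le> (M+1)/(2M)\<close> (\<open>test_strip\<close>), and a Knapp cap of dimensions \<open>\<rho>^M\<close>, \<open>\<rho>^2\<close>, which is
    \<open>\<rho>^(2M)\<close>-flat, gives \<open>1/q \<ge> (3M+2)/(M+2) 1/p - 1\<close> (\<open>test_knapp\<close>).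

  The number \<open>M = \<omega> l + 2\<close> enters through the Hessian determinant. On the line \<open>x\<^sub>1 = 1\<close>, where \<open>\<Phi>\<close> is a
  polynomial \<open>p\<close>, the determinant is \<open>(m-1) (m p p'' - (m-1) p'^2)\<close>. It vanishes identically for \<open>m\<close>-th powers of
  linear forms, and its order of vanishing at \<open>l\<close> is two less than the order to which \<open>p\<close> differs from the
  \<open>m\<close>-th power osculating it at \<open>l\<close> (\<open>hessian_order_eq_contact_order\<close>). Both are polynomials of degree at most
  \<open>m\<close>, and they differ because the determinant does not vanish identically, so \<open>M \<le> m\<close>; together with \<open>1/q \<le> 1/p\<close> this reduces the remaining condition
  \<open>(M/2+1) (1/p - 1/q) \<le> 1\<close> to the one with \<open>m\<close>.
\<close>

section \<open>Sectors\<close>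

lemma open_sector:
  assumes "v \<noteq> 0"
  shows "open (sector \<epsilon> v)"
proof -
  have cont: "continuous_on (- {0}) (\<lambda>x. vec_angle x w)" if "w \<noteq> 0" for w :: "real^2"
    unfolding vec_angle_def
  proof (rule continuous_on_arccos)
    show "continuous_on (- {0}) (\<lambda>x. x \<bullet> w / (norm x * norm w))"
      using that by (intro continuous_intros) auto
    have "\<bar>x \<bullet> w / (norm x * norm w)\<bar> \<le> 1" for x :: "real^2"
      using Cauchy_Schwarz_ineq2[of x w] by (auto simp: abs_mult divide_simps)
    then show "\<forall>x\<in>- {0}. - 1 \<le> x \<bullet> w / (norm x * norm w) \<and> x \<bullet> w / (norm x * norm w) \<le> 1"
      by (metis abs_le_iff minus_le_iff)
  qed
  have op: "open (- {0} \<inter> (\<lambda>x. vec_angle x w) -` {..<\<epsilon>})" if "w \<noteq> 0" for w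
    using cont[OF that] by (intro continuous_open_preimage) auto
  have "sector \<epsilon> v = (- {0} \<inter> (\<lambda>x. vec_angle x v) -` {..<\<epsilon>}) \<union>
     (- {0} \<inter> (\<lambda>x. vec_angle x (- v)) -` {..<\<epsilon>})"
    by (auto simp: sector_def)
  then show ?thesis using op[of v] op[of "- v"] assms by auto
qed

lemma self_in_sector: "v \<noteq> 0 \<Longrightarrow> 0 < \<epsilon> \<Longrightarrow> v \<in> sector \<epsilon> v"
  by (simp add: sector_def vec_angle_def dot_square_norm power2_eq_square)

lemma scaleR_in_sector: "x \<in> sector \<epsilon> v \<Longrightarrow> 0 < s \<Longrightarrow> s *\<^sub>R x \<in> sector \<epsilon> v"
  by (simp add: sector_def vec_angle_def)

section \<open>Indicator functions as tests for the maximal operator\<close>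

definition graph_point :: "(real^2 \<Rightarrow> real) \<Rightarrow> real^2 \<Rightarrow> real^3" where
  "graph_point g x = vector [x$1, x$2, g x]"

lemma graph_point_nth [simp]:
  "graph_point g x $ 1 = x$1" "graph_point g x $ 2 = x$2" "graph_point g x $ 3 = g x"
  by (simp_all add: graph_point_def)

lemma measurable_graph_point:
  assumes "g \<in> borel_measurable borel"
  shows "graph_point g \<in> borel_measurable borel"
proof (rule borel_measurable_euclidean_space[THEN iffD2], rule ballI)
  fix b :: "real^3" assume "b \<in> Basis"
  then obtain i where b: "b = axis i 1" by (auto simp: Basis_vec_def)
  have "(\<lambda>x. graph_point g x $ i) \<in> borel_measurable borel"
    using exhaust_3[of i] assms by auto
  then show "(\<lambda>x. graph_point g x \<bullet> b) \<in> borel_measurable borel"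
    by (simp add: b inner_axis)
qed

text \<open>The hypotheses make the surface measure of the graph of \<open>g\<close> over \<open>D\<close> a finite measure; without
  finiteness a Bochner integral could be \<open>0\<close> by convention and lower bounds for averages would fail.\<close>

locale graph_patch =
  fixes g :: "real^2 \<Rightarrow> real" and D :: "(real^2) set"
  assumes g: "g \<in> borel_measurable borel"
    and partial_g: "partial 1 g \<in> borel_measurable borel" "partial 2 g \<in> borel_measurable borel"
    and D: "D \<in> sets borel" "emeasure lborel D < \<infinity>"
    and bdd_gradient: "bdd_above ((\<lambda>x. sqrt (1 + (partial 1 g x)\<^sup>2 + (partial 2 g x)\<^sup>2)) ` D)"
begin

text \<open>The density \<open>sqrt (1 + |grad g|^2)\<close> is at least \<open>1\<close>, so the surface measure of a piece of the graph
  is bounded below by the area of its projection.\<close>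

lemma local_maximal_indicator_ge:
  assumes F: "F \<in> sets borel" and t: "t \<in> {1..2}"
    and B: "B \<in> sets borel" "B \<subseteq> D" "\<And>x. x \<in> B \<Longrightarrow> y - t *\<^sub>R graph_point g x \<in> F"
  shows "emeasure lborel B \<le>
    local_maximal (graph_surface_measure g D) (\<lambda>x. of_real (indicator F x)) y"
proof -
  obtain K where K: "\<And>x. x \<in> D \<Longrightarrow> sqrt (1 + (partial 1 g x)\<^sup>2 + (partial 2 g x)\<^sup>2) \<le> K"
    using bdd_gradient by (auto simp: bdd_above_def)
  define w where "w = (\<lambda>x. ennreal (sqrt (1 + (partial 1 g x)\<^sup>2 + (partial 2 g x)\<^sup>2)) * indicator D x)"
  define \<sigma> where "\<sigma> = graph_surface_measure g D"
  have \<sigma>: "\<sigma> = distr (density lborel w) borel (graph_point g)"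
    unfolding \<sigma>_def graph_surface_measure_def w_def graph_point_def ..
  have w[measurable]: "w \<in> borel_measurable lborel"
    unfolding w_def using partial_g D by measurable
  have G[measurable]: "graph_point g \<in> borel_measurable borel"
    by (rule measurable_graph_point[OF g])
  have em: "emeasure \<sigma> A = (\<integral>\<^sup>+x. w x * indicator (graph_point g -` A) x \<partial>lborel)"
    if "A \<in> sets borel" for A
    using that unfolding \<sigma>
    by (subst emeasure_distr) (auto intro!: emeasure_density measurable_sets_borel[OF G])
  have UNIV_B: "UNIV \<in> sets (borel :: (real^3) measure)" by simp
  have "emeasure \<sigma> UNIV \<le> (\<integral>\<^sup>+x. ennreal K * indicator D x \<partial>lborel)"
    unfolding em[OF UNIV_B] w_def using K
    by (intro nn_integral_mono) (auto simp: indicator_def intro!: ennreal_leI)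
  also have "\<dots> < \<infinity>" using D by (simp add: nn_integral_cmult_indicator ennreal_mult_less_top)
  finally have "emeasure \<sigma> UNIV < \<infinity>" .
  then have fin: "finite_measure \<sigma>"
    by (intro finite_measureI) (auto simp: \<sigma>)
  define A where "A = {x. y - t *\<^sub>R x \<in> F}"
  have A: "A \<in> sets borel" unfolding A_def using F by measurable
  then have A': "A \<in> sets \<sigma>" by (simp add: \<sigma>)
  have "emeasure lborel B = (\<integral>\<^sup>+x. indicator B x \<partial>lborel)" using B by simp
  also have "\<dots> \<le> emeasure \<sigma> A"
    unfolding em[OF A] w_def
  proof (rule nn_integral_mono)
    fix x :: "real^2"
    have "ennreal 1 \<le> ennreal (sqrt (1 + (partial 1 g x)\<^sup>2 + (partial 2 g x)\<^sup>2))"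
      by (intro ennreal_leI) simp
    then show "indicator B x \<le> ennreal (sqrt (1 + (partial 1 g x)\<^sup>2 + (partial 2 g x)\<^sup>2)) *
        indicator D x * indicator (graph_point g -` A) x"
      using B by (auto simp: indicator_def A_def)
  qed
  also have "\<dots> = ennreal (measure \<sigma> A)"
    using fin by (simp add: finite_measure.emeasure_eq_measure)
  also have "measure \<sigma> A = norm (average \<sigma> t (\<lambda>x. of_real (indicator F x)) y)"
  proof -
    have "average \<sigma> t (\<lambda>x. of_real (indicator F x)) y = (\<integral>x. of_real (indicator A x) \<partial>\<sigma>)"
      unfolding average_def A_def by (simp add: indicator_def)
    also have "\<dots> = of_real (measure \<sigma> A)"
      using A' by (simp add: sets.Int_space_eq2)
    finally show ?thesis by simp
  qed
  also have "ennreal \<dots> \<le> local_maximal \<sigma> (\<lambda>x. of_real (indicator F x)) y"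
    unfolding local_maximal_def using t by (rule SUP_upper)
  finally show ?thesis unfolding \<sigma>_def .
qed

end

lemma Lp_norm_indicator_le:
  fixes p :: ennreal
  assumes p: "1 \<le> p" and F: "F \<in> sets borel" "emeasure lborel F \<le> ennreal \<nu>" and \<nu>: "0 < \<nu>"
  shows "Lp_norm p (\<lambda>x. ennreal (norm (complex_of_real (indicator F x)))) \<le> ennreal (\<nu> powr enn2real (1 / p))"
proof (cases "p = \<infinity>")
  case True
  have "Inf {K. AE x in lborel. ennreal (norm (complex_of_real (indicator F x))) \<le> K} \<le> 1"
    by (intro Inf_lower) (auto simp: indicator_def)
  then show ?thesis using \<nu> True by (simp add: Lp_norm_def ennreal_divide_top)
next
  case False
  then obtain r where r: "p = ennreal r" "1 \<le> r"
    using p by (cases p) (auto simp flip: ennreal_1)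
  then have p': "enn2real p = r" "enn2real (1 / p) = 1 / r"
    by (auto simp: divide_ennreal simp flip: ennreal_1)
  have "(\<integral>\<^sup>+x. epowr (ennreal (norm (complex_of_real (indicator F x)))) r \<partial>lborel)
      = (\<integral>\<^sup>+x. indicator F x \<partial>lborel)"
    using r by (intro nn_integral_cong) (auto simp: indicator_def epowr_def simp flip: ennreal_1)
  also have "\<dots> = emeasure lborel F" using F by simp
  finally have I: "(\<integral>\<^sup>+x. epowr (ennreal (norm (complex_of_real (indicator F x)))) r \<partial>lborel)
     = emeasure lborel F" .
  obtain \<mu> where \<mu>: "emeasure lborel F = ennreal \<mu>" "0 \<le> \<mu>" "\<mu> \<le> \<nu>"
    using F \<nu> by (cases "emeasure lborel F") (auto simp: top_unique)
  have "epowr (ennreal \<mu>) (1 / r) \<le> ennreal (\<nu> powr (1 / r))"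
    using \<mu> r by (auto simp: epowr_def intro!: ennreal_leI powr_mono2)
  then show ?thesis using False I \<mu> by (simp add: Lp_norm_def p')
qed

text \<open>A maximal function may fail to be Borel, but its nonnegative integral is a lower integral and is bounded below
  through the values on the Borel set \<open>E\<close> alone.\<close>

lemma Lp_norm_ge:
  fixes q :: ennreal
  assumes q: "1 \<le> q" and E: "E \<in> sets borel" "ennreal \<mu> \<le> emeasure lborel E" and \<mu>: "0 < \<mu>"
    and h: "\<And>y. y \<in> E \<Longrightarrow> ennreal \<kappa> \<le> h y" and \<kappa>: "0 \<le> \<kappa>"
  shows "ennreal (\<kappa> * \<mu> powr enn2real (1 / q)) \<le> Lp_norm q h"
proof (cases "q = \<infinity>")
  case True
  have "ennreal \<kappa> \<le> K" if "AE x in lborel. h x \<le> K" for K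
  proof (rule ccontr)
    assume "\<not> ennreal \<kappa> \<le> K"
    then have "x \<notin> E" if "h x \<le> K" for x using h[of x] that by (auto simp: not_le)
    with that have "AE x in lborel. x \<notin> E" by (auto elim: eventually_mono)
    then have "emeasure lborel E = 0" using E by (simp add: AE_iff_measurable[OF _ refl])
    then show False using E \<mu> by simp
  qed
  then have "ennreal \<kappa> \<le> Inf {K. AE x in lborel. h x \<le> K}" by (intro Inf_greatest) auto
  then show ?thesis using \<mu> True by (simp add: Lp_norm_def ennreal_divide_top)
next
  case False
  then obtain r where r: "q = ennreal r" "1 \<le> r"
    using q by (cases q) (auto simp flip: ennreal_1)
  then have q': "enn2real q = r" "enn2real (1 / q) = 1 / r"
    by (auto simp: divide_ennreal simp flip: ennreal_1)
  define I where "I = (\<integral>\<^sup>+x. epowr (h x) r \<partial>lborel)"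
  have "ennreal (\<kappa> powr r * \<mu>) \<le> ennreal (\<kappa> powr r) * emeasure lborel E"
    using E \<mu> by (simp add: ennreal_mult mult_left_mono)
  also have "\<dots> = (\<integral>\<^sup>+x. ennreal (\<kappa> powr r) * indicator E x \<partial>lborel)"
    using E by (simp add: nn_integral_cmult_indicator)
  also have "\<dots> \<le> I" unfolding I_def
  proof (rule nn_integral_mono)
    fix x :: "real^3"
    have "ennreal (\<kappa> powr r) \<le> epowr (h x) r" if "x \<in> E"
    proof (cases "h x")
      case (real a)
      then have "\<kappa> \<le> a" using h[OF that] \<kappa> by simp
      then show ?thesis using real r \<kappa> by (auto simp: epowr_def intro!: ennreal_leI powr_mono2)
    qed (simp add: epowr_def)
    then show "ennreal (\<kappa> powr r) * indicator E x \<le> epowr (h x) r" by (simp add: indicator_def)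
  qed
  finally have le: "ennreal (\<kappa> powr r * \<mu>) \<le> I" .
  have "ennreal (\<kappa> * \<mu> powr (1 / r)) \<le> epowr I (1 / r)"
  proof (cases I)
    case (real a)
    then have "\<kappa> powr r * \<mu> \<le> a" using le by simp
    then have "(\<kappa> powr r * \<mu>) powr (1 / r) \<le> a powr (1 / r)"
      using \<mu> r by (intro powr_mono2) auto
    moreover have "(\<kappa> powr r * \<mu>) powr (1 / r) = \<kappa> * \<mu> powr (1 / r)"
      using \<kappa> \<mu> r by (simp add: powr_mult powr_powr)
    ultimately show ?thesis using real by (simp add: epowr_def)
  qed (simp add: epowr_def)
  then show ?thesis using False by (simp add: Lp_norm_def q' I_def)
qed

lemma powr_bounded_imp_nonneg:
  fixes s :: real
  assumes "0 < \<rho>0" and "\<And>\<rho>. 0 < \<rho> \<Longrightarrow> \<rho> < \<rho>0 \<Longrightarrow> \<rho> powr s \<le> K"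
  shows "0 \<le> s"
proof (rule ccontr)
  assume "\<not> 0 \<le> s"
  then have s: "s < 0" by simp
  define \<rho> where "\<rho> = min (\<rho>0 / 2) ((\<bar>K\<bar> + 1) powr (1 / s))"
  have \<rho>: "0 < \<rho>" "\<rho> < \<rho>0" "\<rho> \<le> (\<bar>K\<bar> + 1) powr (1 / s)" using assms(1) by (auto simp: \<rho>_def)
  have "((\<bar>K\<bar> + 1) powr (1 / s)) powr s \<le> \<rho> powr s"
    using \<rho> s by (intro powr_mono2') auto
  then have "\<bar>K\<bar> + 1 \<le> \<rho> powr s" using s by (simp add: powr_powr)
  then show False using assms(2)[OF \<rho>(1,2)] by simp
qed


text \<open>Every condition of the theorem comes from one pair of families of sets \<open>E\<close>, \<open>F\<close>, depending on a scale
  \<open>\<rho>\<close> that tends to \<open>0\<close>. If every \<open>y \<in> E\<close> admits a dilation for which a portion of the surface of area at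
  least \<open>a * \<rho>^\<alpha>\<close>, reflected and moved to \<open>y\<close>, lies in \<open>F\<close>, then the maximal function of the indicator of
  \<open>F\<close> is at least \<open>a * \<rho>^\<alpha>\<close> on \<open>E\<close>, and the norm inequality reads
  \<open>\<rho>^\<alpha> |E|^(1/q) \<le> C |F|^(1/p)\<close>. Comparing powers of \<open>\<rho>\<close> gives a linear inequality between
  \<open>1/p\<close> and \<open>1/q\<close>. The statement covers infinite exponents, for which \<open>1/p\<close> or \<open>1/q\<close> is \<open>0\<close>.\<close>

lemma (in graph_patch) scaling_test:
  fixes p q :: ennreal and \<alpha> \<beta> \<gamma> :: real
  assumes p: "1 \<le> p" and q: "1 \<le> q"
    and bd: "Lp_Lq_bounded p q (local_maximal (graph_surface_measure g D))"
    and pos: "0 < a" "0 < b" "0 < d" "0 < \<rho>0"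
    and test: "\<And>\<rho>. 0 < \<rho> \<Longrightarrow> \<rho> < \<rho>0 \<Longrightarrow> \<exists>E F. E \<in> sets borel \<and> F \<in> sets borel \<and>
      ennreal (b * \<rho> powr \<beta>) \<le> emeasure lborel E \<and> emeasure lborel F \<le> ennreal (d * \<rho> powr \<gamma>) \<and>
      (\<forall>y\<in>E. \<exists>t\<in>{1..2}. \<exists>B\<in>sets borel. B \<subseteq> D \<and> ennreal (a * \<rho> powr \<alpha>) \<le> emeasure lborel B \<and>
         (\<forall>x\<in>B. y - t *\<^sub>R graph_point g x \<in> F))"
  shows "\<gamma> * enn2real (1 / p) \<le> \<alpha> + \<beta> * enn2real (1 / q)"
proof -
  define x where "x = enn2real (1 / p)"
  define y where "y = enn2real (1 / q)"
  obtain C where C: "\<And>f. f \<in> borel_measurable borel \<Longrightarrow> Lp_norm p (\<lambda>x. ennreal (norm (f x))) < \<infinity> \<Longrightarrow>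
      Lp_norm q (local_maximal (graph_surface_measure g D) f) \<le> ennreal C * Lp_norm p (\<lambda>x. ennreal (norm (f x)))"
    using bd unfolding Lp_Lq_bounded_def by blast
  have "\<rho> powr (\<alpha> + \<beta> * y - \<gamma> * x) \<le> max C 0 * d powr x / (a * b powr y)"
    if \<rho>: "0 < \<rho>" "\<rho> < \<rho>0" for \<rho>
  proof -
    obtain E F where E: "E \<in> sets borel" "ennreal (b * \<rho> powr \<beta>) \<le> emeasure lborel E"
      and F: "F \<in> sets borel" "emeasure lborel F \<le> ennreal (d * \<rho> powr \<gamma>)"
      and EF: "\<And>y. y \<in> E \<Longrightarrow> \<exists>t\<in>{1..2}. \<exists>B\<in>sets borel. B \<subseteq> D \<and> ennreal (a * \<rho> powr \<alpha>) \<le> emeasure lborel B \<and>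
         (\<forall>x\<in>B. y - t *\<^sub>R graph_point g x \<in> F)"
      using test[OF \<rho>] by blast
    define f where "f = (\<lambda>x. complex_of_real (indicator F x))"
    have f: "f \<in> borel_measurable borel" unfolding f_def using F(1) by measurable
    have Nf: "Lp_norm p (\<lambda>x. ennreal (norm (f x))) \<le> ennreal ((d * \<rho> powr \<gamma>) powr x)"
      unfolding f_def x_def using p F pos \<rho> by (intro Lp_norm_indicator_le) auto
    then have fin: "Lp_norm p (\<lambda>x. ennreal (norm (f x))) < \<infinity>"
      by (metis ennreal_less_top infinity_ennreal_def order_le_less_trans)
    have "ennreal (a * \<rho> powr \<alpha>) \<le> local_maximal (graph_surface_measure g D) f y" if y: "y \<in> E" for y
    proof -
      obtain t B where t: "t \<in> {1..2}" and B: "B \<in> sets borel" "B \<subseteq> D"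
        "ennreal (a * \<rho> powr \<alpha>) \<le> emeasure lborel B" "\<forall>x\<in>B. y - t *\<^sub>R graph_point g x \<in> F"
        using EF[OF y] by blast
      show ?thesis
        unfolding f_def using B(4) by (intro order_trans[OF B(3) local_maximal_indicator_ge[OF F(1) t B(1,2)]]) blast
    qed
    then have "ennreal (a * \<rho> powr \<alpha> * (b * \<rho> powr \<beta>) powr y)
        \<le> Lp_norm q (local_maximal (graph_surface_measure g D) f)"
      unfolding y_def using q E pos \<rho> by (intro Lp_norm_ge[where E = E]) auto
    also have "\<dots> \<le> ennreal C * Lp_norm p (\<lambda>x. ennreal (norm (f x)))" by (rule C[OF f fin])
    also have "\<dots> \<le> ennreal (max C 0) * ennreal ((d * \<rho> powr \<gamma>) powr x)"
      using Nf by (intro mult_mono ennreal_leI) auto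
    also have "\<dots> = ennreal (max C 0 * (d * \<rho> powr \<gamma>) powr x)" by (simp add: ennreal_mult)
    finally have "a * \<rho> powr \<alpha> * (b * \<rho> powr \<beta>) powr y \<le> max C 0 * (d * \<rho> powr \<gamma>) powr x"
      by (subst (asm) ennreal_le_iff) auto
    then have "(a * b powr y) * \<rho> powr (\<alpha> + \<beta> * y) \<le> max C 0 * d powr x * \<rho> powr (\<gamma> * x)"
      using pos \<rho> by (simp add: powr_mult powr_powr powr_add mult_ac)
    then have "\<rho> powr (\<alpha> + \<beta> * y) \<le> max C 0 * d powr x / (a * b powr y) * \<rho> powr (\<gamma> * x)"
      using pos by (simp add: field_simps)
    then show ?thesis using \<rho> by (simp add: powr_diff divide_le_eq)
  qed
  from powr_bounded_imp_nonneg[OF pos(4) this] show ?thesis unfolding x_def y_def by simp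
qed


lemma (in graph_patch) scaling_test_nat:
  fixes p q :: ennreal and i j k :: nat
  assumes pq: "1 \<le> p" "1 \<le> q"
    and bd: "Lp_Lq_bounded p q (local_maximal (graph_surface_measure g D))"
    and pos: "0 < a" "0 < b" "0 < d" "0 < \<rho>0"
    and test: "\<And>\<rho>. 0 < \<rho> \<Longrightarrow> \<rho> < \<rho>0 \<Longrightarrow> \<exists>E F. E \<in> sets borel \<and> F \<in> sets borel \<and>
      ennreal (b * \<rho> ^ j) \<le> emeasure lborel E \<and> emeasure lborel F \<le> ennreal (d * \<rho> ^ k) \<and>
      (\<forall>y\<in>E. \<exists>t\<in>{1..2}. \<exists>B\<in>sets borel. B \<subseteq> D \<and> ennreal (a * \<rho> ^ i) \<le> emeasure lborel B \<and>
         (\<forall>x\<in>B. y - t *\<^sub>R graph_point g x \<in> F))"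
  shows "real k * enn2real (1 / p) \<le> real i + real j * enn2real (1 / q)"
proof (rule scaling_test[OF pq bd pos])
  fix \<rho> :: real assume "0 < \<rho>" "\<rho> < \<rho>0"
  then show "\<exists>E F. E \<in> sets borel \<and> F \<in> sets borel \<and>
      ennreal (b * \<rho> powr real j) \<le> emeasure lborel E \<and> emeasure lborel F \<le> ennreal (d * \<rho> powr real k) \<and>
      (\<forall>y\<in>E. \<exists>t\<in>{1..2}. \<exists>B\<in>sets borel. B \<subseteq> D \<and> ennreal (a * \<rho> powr real i) \<le> emeasure lborel B \<and>
         (\<forall>x\<in>B. y - t *\<^sub>R graph_point g x \<in> F))"
    unfolding powr_realpow[OF \<open>0 < \<rho>\<close>] by (rule test)
qed

section \<open>Volumes of skew boxes\<close>

lemma emeasure_lborel_linear_box: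
  fixes A :: "real^('n::{finite,wellorder})^('n::{finite,wellorder})" and c r :: "real^('n::{finite,wellorder})"
  assumes det: "det A \<noteq> 0" and r: "\<And>i. 0 \<le> r $ i"
  defines "S \<equiv> {v. \<forall>i. \<bar>(A *v v) $ i - c $ i\<bar> \<le> r $ i}"
  shows "S \<in> sets borel" "emeasure lborel S = ennreal ((\<Prod>i\<in>UNIV. 2 * r $ i) / \<bar>det A\<bar>)"
proof -
  obtain A' where inv: "A ** A' = mat 1" "A' ** A = mat 1"
    using det invertible_det_nz[of A] unfolding invertible_def by auto
  have mem: "v \<in> S \<longleftrightarrow> A *v v \<in> cbox (c - r) (c + r)" for v
    by (simp add: S_def mem_box_cart abs_diff_le_iff)
  have S: "S = (*v) A' ` cbox (c - r) (c + r)"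
  proof (intro set_eqI iffI)
    fix v assume "v \<in> S"
    moreover have "v = A' *v (A *v v)" using inv by (simp add: matrix_vector_mul_assoc)
    ultimately show "v \<in> (*v) A' ` cbox (c - r) (c + r)" unfolding mem by (rule rev_image_eqI)
  next
    fix v assume "v \<in> (*v) A' ` cbox (c - r) (c + r)"
    then obtain w where w: "w \<in> cbox (c - r) (c + r)" "v = A' *v w" by blast
    then have "A *v v = w" using inv by (simp add: matrix_vector_mul_assoc)
    then show "v \<in> S" using w(1) by (simp add: mem)
  qed
  have "compact S" unfolding S
    by (intro compact_continuous_image compact_cbox matrix_vector_mult_linear_continuous_on)
  then show borel: "S \<in> sets borel" by (simp add: borel_compact)
  have le: "c - r \<le> c + r" using r by (simp add: less_eq_vec_def)
  have "det A * det (A') = 1"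
    using det_mul[of A A'] inv(1) by (simp add: det_I)
  then have d: "det (A') = 1 / det A" using det by (simp add: field_simps)
  have ne: "cbox (c - r) (c + r) \<noteq> {}" using r by (simp add: interval_ne_empty_cart add_increasing2 diff_le_eq)
  have "measure lebesgue S = \<bar>det (matrix ((*v) (A')))\<bar> * measure lebesgue (cbox (c - r) (c + r))"
    unfolding S by (intro measure_linear_image) auto
  also have "\<dots> = (\<Prod>i\<in>UNIV. 2 * r $ i) / \<bar>det A\<bar>"
    using ne by (simp add: d content_cbox_cart)
  finally have m: "measure lebesgue S = (\<Prod>i\<in>UNIV. 2 * r $ i) / \<bar>det A\<bar>" .
  have "S \<in> lmeasurable" unfolding S by (intro measurable_linear_image) auto
  then have "emeasure lebesgue S = ennreal (measure lebesgue S)" by (simp add: emeasure_eq_measure2)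
  then show "emeasure lborel S = ennreal ((\<Prod>i\<in>UNIV. 2 * r $ i) / \<bar>det A\<bar>)"
    using borel m by (simp add: emeasure_completion)
qed

lemma emeasure_box_2:
  fixes a b :: "real^2" and c1 c2 r1 r2 :: real
  assumes det: "a$1 * b$2 - a$2 * b$1 \<noteq> 0" and r: "0 \<le> r1" "0 \<le> r2"
  shows "{v. \<bar>a \<bullet> v - c1\<bar> \<le> r1 \<and> \<bar>b \<bullet> v - c2\<bar> \<le> r2} \<in> sets borel"
    "emeasure lborel {v. \<bar>a \<bullet> v - c1\<bar> \<le> r1 \<and> \<bar>b \<bullet> v - c2\<bar> \<le> r2}
      = ennreal (4 * r1 * r2 / \<bar>a$1 * b$2 - a$2 * b$1\<bar>)"
proof -
  define A :: "real^2^2" where "A = vector [a, b]"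
  define s :: "real^2" where "s = vector [r1, r2]"
  define c :: "real^2" where "c = vector [c1, c2]"
  have S: "{v. \<bar>a \<bullet> v - c1\<bar> \<le> r1 \<and> \<bar>b \<bullet> v - c2\<bar> \<le> r2} = {v. \<forall>i. \<bar>(A *v v) $ i - c $ i\<bar> \<le> s $ i}"
    by (simp add: A_def s_def c_def forall_2 matrix_vector_mul_component)
  have d: "det A = a$1 * b$2 - a$2 * b$1" by (simp add: A_def det_2)
  then have dn: "det A \<noteq> 0" using det by simp
  have s: "0 \<le> s $ i" for i using r exhaust_2[of i] by (auto simp: s_def)
  have P: "(\<Prod>i\<in>UNIV. 2 * s $ i) = 4 * r1 * r2" by (simp add: s_def UNIV_2)
  note box = emeasure_lborel_linear_box[OF dn s, of c]
  show "{v. \<bar>a \<bullet> v - c1\<bar> \<le> r1 \<and> \<bar>b \<bullet> v - c2\<bar> \<le> r2} \<in> sets borel"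
    unfolding S by (rule box(1))
  show "emeasure lborel {v. \<bar>a \<bullet> v - c1\<bar> \<le> r1 \<and> \<bar>b \<bullet> v - c2\<bar> \<le> r2}
      = ennreal (4 * r1 * r2 / \<bar>a$1 * b$2 - a$2 * b$1\<bar>)"
    unfolding S box(2) P d ..
qed

lemma emeasure_box_3:
  fixes a1 a2 a3 :: "real^3" and c1 c2 c3 r1 r2 r3 :: real
  assumes det: "det (vector [a1, a2, a3] :: real^3^3) \<noteq> 0" and r: "0 \<le> r1" "0 \<le> r2" "0 \<le> r3"
  shows "{v. \<bar>a1 \<bullet> v - c1\<bar> \<le> r1 \<and> \<bar>a2 \<bullet> v - c2\<bar> \<le> r2 \<and> \<bar>a3 \<bullet> v - c3\<bar> \<le> r3} \<in> sets borel"
    "emeasure lborel {v. \<bar>a1 \<bullet> v - c1\<bar> \<le> r1 \<and> \<bar>a2 \<bullet> v - c2\<bar> \<le> r2 \<and> \<bar>a3 \<bullet> v - c3\<bar> \<le> r3}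
      = ennreal (8 * r1 * r2 * r3 / \<bar>det (vector [a1, a2, a3] :: real^3^3)\<bar>)"
proof -
  define A :: "real^3^3" where "A = vector [a1, a2, a3]"
  define s :: "real^3" where "s = vector [r1, r2, r3]"
  define c :: "real^3" where "c = vector [c1, c2, c3]"
  have S: "{v. \<bar>a1 \<bullet> v - c1\<bar> \<le> r1 \<and> \<bar>a2 \<bullet> v - c2\<bar> \<le> r2 \<and> \<bar>a3 \<bullet> v - c3\<bar> \<le> r3}
      = {v. \<forall>i. \<bar>(A *v v) $ i - c $ i\<bar> \<le> s $ i}"
    by (simp only: A_def s_def c_def forall_3 matrix_vector_mul_component vector_3)
  have dn: "det A \<noteq> 0" using det by (simp add: A_def)
  have "\<forall>i. 0 \<le> s $ i" using r by (simp add: forall_3 s_def)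
  then have s: "0 \<le> s $ i" for i by blast
  have prod3: "(\<Prod>i\<in>UNIV. f i) = f 1 * f 2 * f 3" for f :: "3 \<Rightarrow> real"
    unfolding UNIV_3 by (simp add: ac_simps)
  have P: "(\<Prod>i\<in>UNIV. 2 * s $ i) = 8 * r1 * r2 * r3"
    unfolding prod3 s_def vector_3 by (simp only: mult_ac)
  note box = emeasure_lborel_linear_box[OF dn s, of c]
  show "{v. \<bar>a1 \<bullet> v - c1\<bar> \<le> r1 \<and> \<bar>a2 \<bullet> v - c2\<bar> \<le> r2 \<and> \<bar>a3 \<bullet> v - c3\<bar> \<le> r3} \<in> sets borel"
    unfolding S by (rule box(1))
  show "emeasure lborel {v. \<bar>a1 \<bullet> v - c1\<bar> \<le> r1 \<and> \<bar>a2 \<bullet> v - c2\<bar> \<le> r2 \<and> \<bar>a3 \<bullet> v - c3\<bar> \<le> r3}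
      = ennreal (8 * r1 * r2 * r3 / \<bar>det (vector [a1, a2, a3] :: real^3^3)\<bar>)"
    unfolding S box(2) P by (simp add: A_def)
qed


text \<open>The sets used later are boxes in the coordinates \<open>x\<^sub>1 + \<beta> (x\<^sub>2 - l x\<^sub>1)\<close> and \<open>x\<^sub>2 - l x\<^sub>1\<close> of the plane, a
  linear change of variables of determinant \<open>1\<close>; for \<open>\<beta> = l = 0\<close> they are the Cartesian ones.\<close>

lemma emeasure_skew_box_2:
  fixes l \<beta> c1 c2 r1 r2 :: real
  assumes r: "0 \<le> r1" "0 \<le> r2"
  defines "S \<equiv> {x :: real^2. \<bar>x$1 + \<beta> * (x$2 - l * x$1) - c1\<bar> \<le> r1 \<and> \<bar>x$2 - l * x$1 - c2\<bar> \<le> r2}"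
  shows "S \<in> sets borel" "emeasure lborel S = ennreal (4 * r1 * r2)"
proof -
  define a :: "real^2" where "a = vector [1 - \<beta> * l, \<beta>]"
  define b :: "real^2" where "b = vector [- l, 1]"
  have S: "S = {x. \<bar>a \<bullet> x - c1\<bar> \<le> r1 \<and> \<bar>b \<bullet> x - c2\<bar> \<le> r2}"
    by (simp add: S_def a_def b_def inner_vec_def sum_2 algebra_simps)
  have det: "a$1 * b$2 - a$2 * b$1 = 1" by (simp add: a_def b_def)
  show "S \<in> sets borel" unfolding S by (rule emeasure_box_2) (use det r in auto)
  show "emeasure lborel S = ennreal (4 * r1 * r2)"
    unfolding S by (subst emeasure_box_2) (use det r in auto)
qed

text \<open>In space, linear combinations of the first coordinate with \<open>v\<^sub>3\<close> are allowed as well; this covers the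
  distance to a tangent plane of the surface.\<close>

lemma emeasure_skew_box_3:
  fixes l \<beta> c1 c2 c3 r1 r2 r3 \<alpha>1 \<gamma>1 \<alpha>3 \<gamma>3 :: real
  assumes r: "0 \<le> r1" "0 \<le> r2" "0 \<le> r3" and \<Delta>: "\<alpha>1 * \<gamma>3 - \<gamma>1 * \<alpha>3 \<noteq> 0"
  defines "S \<equiv> {v :: real^3. \<bar>\<alpha>1 * (v$1 + \<beta> * (v$2 - l * v$1)) + \<gamma>1 * v$3 - c1\<bar> \<le> r1 \<and>
      \<bar>v$2 - l * v$1 - c2\<bar> \<le> r2 \<and> \<bar>\<alpha>3 * (v$1 + \<beta> * (v$2 - l * v$1)) + \<gamma>3 * v$3 - c3\<bar> \<le> r3}"
  shows "S \<in> sets borel" "emeasure lborel S = ennreal (8 * r1 * r2 * r3 / \<bar>\<alpha>1 * \<gamma>3 - \<gamma>1 * \<alpha>3\<bar>)"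
proof -
  define a1 :: "real^3" where "a1 = vector [\<alpha>1 * (1 - \<beta> * l), \<alpha>1 * \<beta>, \<gamma>1]"
  define a2 :: "real^3" where "a2 = vector [- l, 1, 0]"
  define a3 :: "real^3" where "a3 = vector [\<alpha>3 * (1 - \<beta> * l), \<alpha>3 * \<beta>, \<gamma>3]"
  have S: "S = {v. \<bar>a1 \<bullet> v - c1\<bar> \<le> r1 \<and> \<bar>a2 \<bullet> v - c2\<bar> \<le> r2 \<and> \<bar>a3 \<bullet> v - c3\<bar> \<le> r3}"
    by (simp add: S_def a1_def a2_def a3_def inner_vec_def sum_3 algebra_simps)
  have det: "det (vector [a1, a2, a3] :: real^3^3) = \<alpha>1 * \<gamma>3 - \<gamma>1 * \<alpha>3"
    by (simp add: det_3 a1_def a2_def a3_def algebra_simps)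
  show "S \<in> sets borel" unfolding S by (rule emeasure_box_3) (use det \<Delta> r in auto)
  show "emeasure lborel S = ennreal (8 * r1 * r2 * r3 / \<bar>\<alpha>1 * \<gamma>3 - \<gamma>1 * \<alpha>3\<bar>)"
    unfolding S by (subst emeasure_box_3) (use det \<Delta> r in auto)
qed

section \<open>Binary forms and their Hessian determinant\<close>

text \<open>Arbitrary exponent sequences \<open>k\<close> and \<open>e\<close> make this class of functions closed under both partial
  derivatives, which homogeneous polynomials of a fixed degree are not.\<close>

definition bin_poly :: "nat \<Rightarrow> (nat \<Rightarrow> real) \<Rightarrow> (nat \<Rightarrow> nat) \<Rightarrow> (nat \<Rightarrow> nat) \<Rightarrow> real^2 \<Rightarrow> real" where
  "bin_poly d a k e x = (\<Sum>i\<le>d. a i * (x$1) ^ k i * (x$2) ^ e i)"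

lemma continuous_bin_poly: "continuous_on S (bin_poly d a k e)"
  unfolding bin_poly_def by (intro continuous_intros)

lemma partial_bin_poly:
  "partial 1 (\<lambda>x. bin_poly d a k e x + c) = bin_poly d (\<lambda>i. a i * real (k i)) (\<lambda>i. k i - 1) e"
  "partial 2 (\<lambda>x. bin_poly d a k e x + c) = bin_poly d (\<lambda>i. a i * real (e i)) k (\<lambda>i. e i - 1)"
proof -
  show "partial 1 (\<lambda>x. bin_poly d a k e x + c) = bin_poly d (\<lambda>i. a i * real (k i)) (\<lambda>i. k i - 1) e"
  proof
    fix x :: "real^2"
    have "((\<lambda>s. (\<Sum>i\<le>d. a i * (x$1 + s) ^ k i * (x$2) ^ e i) + c) has_field_derivative
        (\<Sum>i\<le>d. a i * real (k i) * (x$1) ^ (k i - 1) * (x$2) ^ e i)) (at 0)"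
      by (auto intro!: derivative_eq_intros sum.cong)
    then show "partial 1 (\<lambda>x. bin_poly d a k e x + c) x = bin_poly d (\<lambda>i. a i * real (k i)) (\<lambda>i. k i - 1) e x"
      by (simp add: partial_def bin_poly_def axis_def DERIV_imp_deriv)
  qed
  show "partial 2 (\<lambda>x. bin_poly d a k e x + c) = bin_poly d (\<lambda>i. a i * real (e i)) k (\<lambda>i. e i - 1)"
  proof
    fix x :: "real^2"
    have "((\<lambda>s. (\<Sum>i\<le>d. a i * (x$1) ^ k i * (x$2 + s) ^ e i) + c) has_field_derivative
        (\<Sum>i\<le>d. a i * real (e i) * (x$1) ^ k i * (x$2) ^ (e i - 1))) (at 0)"
      by (auto intro!: derivative_eq_intros sum.cong)
    then show "partial 2 (\<lambda>x. bin_poly d a k e x + c) x = bin_poly d (\<lambda>i. a i * real (e i)) k (\<lambda>i. e i - 1) x"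
      by (simp add: partial_def bin_poly_def axis_def DERIV_imp_deriv)
  qed
qed

lemma homogeneous_poly_iff_bin_poly:
  "homogeneous_poly d F \<longleftrightarrow> (\<exists>a. F = bin_poly d a (\<lambda>i. i) (\<lambda>i. d - i))"
  unfolding homogeneous_poly_def bin_poly_def fun_eq_iff ..

lemma homogeneous_poly_scaleR:
  assumes "homogeneous_poly d F"
  shows "F (s *\<^sub>R x) = s ^ d * F x"
proof -
  obtain a where F: "F = bin_poly d a (\<lambda>i. i) (\<lambda>i. d - i)"
    using assms homogeneous_poly_iff_bin_poly by blast
  have "a i * (s * x$1) ^ i * (s * x$2) ^ (d - i) = s ^ d * (a i * (x$1) ^ i * (x$2) ^ (d - i))"
    if "i \<le> d" for i
  proof -
    have "s ^ d = s ^ i * s ^ (d - i)" using that by (simp flip: power_add)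
    then show ?thesis by (simp add: power_mult_distrib mult_ac)
  qed
  then have "F (s *\<^sub>R x) = (\<Sum>i\<le>d. s ^ d * (a i * (x$1) ^ i * (x$2) ^ (d - i)))"
    unfolding F bin_poly_def by (intro sum.cong) auto
  then show ?thesis by (simp add: F bin_poly_def sum_distrib_left)
qed

lemma pderiv_sum: "pderiv (sum f A) = (\<Sum>x\<in>A. pderiv (f x))"
  using higher_pderiv_sum[of 1 f A] by simp

text \<open>Restricting a form of degree \<open>d\<close> to the line \<open>x\<^sub>1 = 1\<close> gives a polynomial \<open>p\<close>. By Euler's relations the
  partial derivatives in the direction \<open>x\<^sub>1\<close> are combinations of \<open>p\<close>, \<open>p'\<close> and \<open>p''\<close>, and in the Hessian
  determinant all terms with explicit powers of \<open>v\<close> cancel, leaving \<open>(d-1) (d p p'' - (d-1) p'^2)\<close>.\<close>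

lemma dehomogenization:
  assumes "homogeneous_poly d F"
  obtains p where "degree p \<le> d" "\<And>v. F (vector [1, v]) = poly p v"
    "\<And>v. hessian_det F (vector [1, v]) =
       (real d - 1) * (real d * poly p v * poly (pderiv (pderiv p)) v - (real d - 1) * (poly (pderiv p) v)\<^sup>2)"
proof -
  obtain a where F: "F = bin_poly d a (\<lambda>i. i) (\<lambda>i. d - i)"
    using assms homogeneous_poly_iff_bin_poly by blast
  define p where "p = (\<Sum>i\<le>d. monom (a i) (d - i))"
  have p: "poly p v = (\<Sum>i\<le>d. a i * v ^ (d - i))" for v
    by (simp add: p_def poly_sum poly_monom)
  have p1: "poly (pderiv p) v = (\<Sum>i\<le>d. a i * (real (d - i) * v ^ (d - i - 1)))" for v
    by (simp add: p_def pderiv_sum pderiv_monom poly_sum poly_monom mult_ac)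
  have p2: "poly (pderiv (pderiv p)) v
      = (\<Sum>i\<le>d. a i * (real (d - i) * real (d - i - 1) * v ^ (d - i - 1 - 1)))" for v
    by (simp add: p_def pderiv_sum pderiv_monom poly_sum poly_monom mult_ac)
  show thesis
  proof
    show "degree p \<le> d" unfolding p_def
      by (intro degree_sum_le) (auto intro: order_trans[OF degree_monom_le])
    show "F (vector [1, v]) = poly p v" for v by (simp add: F bin_poly_def p)
  next
    fix v :: real
    note P = partial_bin_poly[where c = 0, simplified]
    let ?x = "vector [1, v] :: real^2"
    have F22: "partial 2 (partial 2 F) ?x = poly (pderiv (pderiv p)) v"
      by (simp add: F P bin_poly_def p2 mult_ac)
    have "partial 1 (partial 2 F) ?x = (\<Sum>i\<le>d. a i * (real (d - i) * real i * v ^ (d - i - 1)))"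
      by (simp add: F P bin_poly_def mult_ac)
    also have "\<dots> = (\<Sum>i\<le>d. (real d - 1) * (a i * (real (d - i) * v ^ (d - i - 1))) -
        v * (a i * (real (d - i) * real (d - i - 1) * v ^ (d - i - 1 - 1))))"
    proof (intro sum.cong refl)
      fix i assume "i \<in> {..d}"
      define j where "j = d - i"
      with \<open>i \<in> {..d}\<close> have i: "real i = real d - real j" and dj: "d - i = j" by auto
      show "a i * (real (d - i) * real i * v ^ (d - i - 1)) =
        (real d - 1) * (a i * (real (d - i) * v ^ (d - i - 1))) -
        v * (a i * (real (d - i) * real (d - i - 1) * v ^ (d - i - 1 - 1)))"
        unfolding dj i by (cases j rule: nat.exhaust; cases "j - 1") (auto simp: algebra_simps)
    qed
    also have "\<dots> = (real d - 1) * poly (pderiv p) v - v * poly (pderiv (pderiv p)) v"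
      by (simp add: p1 p2 sum_subtractf sum_distrib_left)
    finally have F12: "partial 1 (partial 2 F) ?x = \<dots>" .
    have "partial 1 (partial 1 F) ?x = (\<Sum>i\<le>d. a i * (real i * real (i - 1) * v ^ (d - i)))"
      by (simp add: F P bin_poly_def mult_ac)
    also have "\<dots> = (\<Sum>i\<le>d. real d * (real d - 1) * (a i * v ^ (d - i)) -
        2 * (real d - 1) * v * (a i * (real (d - i) * v ^ (d - i - 1))) +
        v\<^sup>2 * (a i * (real (d - i) * real (d - i - 1) * v ^ (d - i - 1 - 1))))"
    proof (intro sum.cong refl)
      fix i assume "i \<in> {..d}"
      define j where "j = d - i"
      with \<open>i \<in> {..d}\<close> have i: "real i = real d - real j" and dj: "d - i = j" by auto
      have i1: "real i * real (i - 1) = (real d - real j) * (real d - real j - 1)"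
        unfolding i[symmetric] by (cases i) auto
      show "a i * (real i * real (i - 1) * v ^ (d - i)) =
        real d * (real d - 1) * (a i * v ^ (d - i)) -
        2 * (real d - 1) * v * (a i * (real (d - i) * v ^ (d - i - 1))) +
        v\<^sup>2 * (a i * (real (d - i) * real (d - i - 1) * v ^ (d - i - 1 - 1)))"
        unfolding dj i1 by (cases j rule: nat.exhaust; cases "j - 1") (auto simp: algebra_simps power2_eq_square)
    qed
    also have "\<dots> = real d * (real d - 1) * poly p v - 2 * (real d - 1) * v * poly (pderiv p) v
        + v\<^sup>2 * poly (pderiv (pderiv p)) v"
      by (simp add: p p1 p2 sum_subtractf sum.distrib sum_distrib_left)
    finally have F11: "partial 1 (partial 1 F) ?x = \<dots>" .
    show "hessian_det F ?x =
       (real d - 1) * (real d * poly p v * poly (pderiv (pderiv p)) v - (real d - 1) * (poly (pderiv p) v)\<^sup>2)"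
      unfolding hessian_det_def F11 F12 F22 by (simp add: algebra_simps power2_eq_square)
  qed
qed

section \<open>Contact with the osculating power of a linear form\<close>

text \<open>Both cofactors are only asked to be continuous, since the one that comes from the factorization of the Hessian
  determinant involves the factors of all the other degenerate lines.\<close>

lemma vanishing_order_unique:
  fixes r s :: "real \<Rightarrow> real"
  assumes "isCont r 0" "isCont s 0" "r 0 \<noteq> 0" "s 0 \<noteq> 0"
    and eq: "\<And>u. u ^ n * s u = u ^ k * r u"
  shows "n = k"
proof -
  have *: "\<not> n < k" if "isCont r 0" "isCont s 0" "s 0 \<noteq> 0" "\<And>u. u ^ n * s u = u ^ k * r u"
    for n k and r s :: "real \<Rightarrow> real"
  proof
    assume nk: "n < k"
    have "s u = u ^ (k - n) * r u" if "u \<noteq> 0" for u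
    proof -
      have "u ^ n * s u = u ^ n * (u ^ (k - n) * r u)"
        using \<open>u ^ n * s u = u ^ k * r u\<close> nk by (simp flip: mult.assoc power_add)
      then show ?thesis using \<open>u \<noteq> 0\<close> by simp
    qed
    then have "eventually (\<lambda>u. u ^ (k - n) * r u = s u) (at 0)"
      by (simp add: eventually_at_filter)
    moreover have "((\<lambda>u. u ^ (k - n) * r u) \<longlongrightarrow> 0 ^ (k - n) * r 0) (at 0)"
      using that(1) by (intro tendsto_intros) (simp add: isCont_def)
    ultimately have "(s \<longlongrightarrow> 0 ^ (k - n) * r 0) (at 0)"
      by (rule Lim_transform_eventually[rotated])
    then have "(s \<longlongrightarrow> 0) (at 0)" using nk by (simp add: power_0_left)
    moreover have "(s \<longlongrightarrow> s 0) (at 0)" using that(2) by (simp add: isCont_def)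
    ultimately show False using that(3) LIM_unique by blast
  qed
  show ?thesis
    using *[of r s n k] *[of s r k n] assms by (metis linorder_neqE_nat)
qed

text \<open>Let \<open>p(l+u)\<close> be \<open>\<Phi>\<close> on the line \<open>x\<^sub>1 = 1\<close>, and subtract from it the \<open>m\<close>-th power \<open>P(u) = \<phi> (1 + \<beta> u)^m\<close>
  that agrees with it to first order at \<open>u = 0\<close>. Powers of linear forms have vanishing Hessian
  determinant, \<open>m P P'' = (m-1) P'^2\<close>. Hence if the difference \<open>g\<close> vanishes to order \<open>k\<close> then the
  Hessian determinant along the line is dominated by \<open>m P g''\<close> and vanishes to order exactly \<open>k - 2\<close>, so that
  \<open>k = \<omega> l + 2\<close>. As \<open>g\<close> is a nonzero polynomial of degree at most \<open>m\<close>, its order of vanishing is at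
  most \<open>m\<close>. This bound is what makes \<open>(M/2+1) (1/p-1/q) \<le> 1\<close> a consequence of the same inequality with \<open>m\<close>
  in place of \<open>M\<close>.\<close>

lemma hessian_order_eq_contact_order:
  assumes m: "2 \<le> m" and hom: "homogeneous_poly m \<Phi>"
    and fac: "hessian_factorization \<Phi> R \<alpha> \<omega> Q" and l: "l \<in> R" and B: "type_B \<Phi> l"
  obtains \<beta> \<phi> r where "\<phi> \<noteq> 0" "\<omega> l + 2 \<le> m"
    "\<And>u. \<Phi> (vector [1, l + u]) = \<phi> * (1 + \<beta> * u) ^ m + u ^ (\<omega> l + 2) * poly r u"
proof -
  obtain p where deg: "degree p \<le> m" and p: "\<And>v. \<Phi> (vector [1, v]) = poly p v"
    and H: "\<And>v. hessian_det \<Phi> (vector [1, v]) =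
       (real m - 1) * (real m * poly p v * poly (pderiv (pderiv p)) v - (real m - 1) * (poly (pderiv p) v)\<^sup>2)"
    by (rule dehomogenization[OF hom]) (rule that)
  define \<phi> where "\<phi> = poly p l"
  have \<phi>: "\<phi> \<noteq> 0"
  proof -
    have "(vector [1, l] :: real^2) \<noteq> 0" by (simp add: vec_eq_iff forall_2)
    then have "(vector [1, l] :: real^2) \<in> L_line l - {0}" by (simp add: L_line_def)
    then show ?thesis using B by (simp add: type_B_def \<phi>_def p[symmetric])
  qed
  define \<beta> where "\<beta> = poly (pderiv p) l / (real m * \<phi>)"
  define q where "q = pcompose p [:l, 1:]"
  define P where "P = smult \<phi> ([:1, \<beta>:] ^ m)"
  have q: "poly q u = poly p (l + u)" for u by (simp add: q_def poly_pcompose)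
  have q1: "pderiv q = pcompose (pderiv p) [:l, 1:]"
    by (simp add: q_def pderiv_pcompose pderiv_pCons)
  have q2: "pderiv (pderiv q) = pcompose (pderiv (pderiv p)) [:l, 1:]"
    by (simp add: q1 pderiv_pcompose pderiv_pCons)
  have Hq: "hessian_det \<Phi> (vector [1, l + u]) =
      (real m - 1) * (real m * poly q u * poly (pderiv (pderiv q)) u - (real m - 1) * (poly (pderiv q) u)\<^sup>2)"
    for u
  proof -
    have "poly (pderiv q) u = poly (pderiv p) (l + u)" by (simp add: q1 poly_pcompose)
    moreover have "poly (pderiv (pderiv q)) u = poly (pderiv (pderiv p)) (l + u)"
      unfolding q2 by (simp add: poly_pcompose)
    ultimately show ?thesis by (simp only: H q)
  qed
  obtain n where n: "m = Suc (Suc n)" using m by (metis add_2_eq_Suc le_Suc_ex)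
  have P0: "poly P u = \<phi> * (1 + \<beta> * u) ^ m" for u by (simp add: P_def mult_ac)
  have pd: "pderiv [:1, \<beta>:] = [:\<beta>:]" by (simp add: pderiv_pCons)
  have D1: "pderiv P = smult (\<phi> * real m * \<beta>) ([:1, \<beta>:] ^ Suc n)"
    unfolding P_def n pderiv_smult pderiv_power_Suc pd by (simp del: power_Suc add: mult_ac)
  have D2: "pderiv (pderiv P) = smult (\<phi> * real m * \<beta> * (real m - 1) * \<beta>) ([:1, \<beta>:] ^ n)"
    unfolding D1 pderiv_smult pderiv_power_Suc pd by (simp add: n mult_ac)
  have P1: "poly (pderiv P) u = \<phi> * (real m * \<beta> * (1 + \<beta> * u) ^ Suc n)" for u
    unfolding D1 by (simp add: algebra_simps)
  have P2: "poly (pderiv (pderiv P)) u = \<phi> * (real m * (real m - 1) * \<beta>\<^sup>2 * (1 + \<beta> * u) ^ n)" for u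
    unfolding D2 by (simp add: power2_eq_square mult_ac)
  have HP: "real m * poly P u * poly (pderiv (pderiv P)) u = (real m - 1) * (poly (pderiv P) u)\<^sup>2" for u
  proof -
    define z where "z = 1 + \<beta> * u"
    have z: "z ^ m = z * z * z ^ n" "z ^ Suc n = z * z ^ n" by (simp_all add: n)
    show ?thesis unfolding P0 P1 P2 z_def[symmetric] z by (simp only: power2_eq_square mult_ac)
  qed
  \<comment> \<open>\<open>S\<close> collects the factors that do not vanish on the line \<open>L_line l\<close>\<close>
  obtain S where Scont: "isCont S 0" and S0: "S 0 \<noteq> 0"
    and S: "\<And>u. hessian_det \<Phi> (vector [1, l + u]) = u ^ \<omega> l * S u"
  proof -
    have fin: "finite R" and Qnz: "\<And>x. x \<noteq> 0 \<Longrightarrow> Q x \<noteq> 0"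
      and HQ: "\<And>x. hessian_det \<Phi> x = (x$1) ^ \<alpha> * (\<Prod>l\<in>R. (x$2 - l * x$1) ^ \<omega> l) * Q x"
      using fac unfolding hessian_factorization_def by blast+
    obtain d where "homogeneous_poly d Q" using fac unfolding hessian_factorization_def by blast
    then obtain s where s: "\<And>v. Q (vector [1, v]) = poly s v" using dehomogenization by metis
    show thesis
    proof
      show "isCont (\<lambda>u. (\<Prod>k\<in>R - {l}. (l + u - k) ^ \<omega> k) * poly s (l + u)) 0"
        by (intro continuous_intros)
      have "poly s l \<noteq> 0" using Qnz[of "vector [1, l]"] by (simp add: s vec_eq_iff forall_2)
      then show "(\<Prod>k\<in>R - {l}. (l + 0 - k) ^ \<omega> k) * poly s (l + 0) \<noteq> 0"
        using fin by simp
      show "hessian_det \<Phi> (vector [1, l + u]) =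
          u ^ \<omega> l * ((\<Prod>k\<in>R - {l}. (l + u - k) ^ \<omega> k) * poly s (l + u))" for u
        using fin l by (simp add: HQ s prod.remove mult.assoc)
    qed
  qed
  define g where "g = q - P"
  have gq: "q = P + g" by (simp add: g_def)
  have "g \<noteq> 0"
  proof
    assume "g = 0"
    then have "u ^ \<omega> l * S u = 0" for u using S[of u] Hq[of u] HP[of u] gq by simp
    then have "S u = 0" if "u \<noteq> 0" for u using that by (metis mult_eq_0_iff power_not_zero)
    then have "eventually (\<lambda>u. S u = 0) (at 0)" by (simp add: eventually_at_filter)
    then have "(S \<longlongrightarrow> 0) (at 0)" by (rule tendsto_eventually)
    moreover have "(S \<longlongrightarrow> S 0) (at 0)" using Scont by (simp add: isCont_def)
    ultimately show False using S0 LIM_unique by blast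
  qed
  from order_decomp[OF this, of 0] obtain r where
    r: "g = [:0, 1:] ^ order 0 g * r" and nd: "\<not> [:0, 1:] dvd r" by auto
  have r0: "poly r 0 \<noteq> 0" using nd by (simp add: poly_eq_0_iff_dvd)
  have "poly g 0 = 0" by (simp add: g_def q P0 \<phi>_def)
  then have k0: "order 0 g \<noteq> 0" using r r0 by (metis power_0 mult_1)
  have g1: "poly (pderiv g) 0 = 0" using \<phi> m
    by (simp add: g_def pderiv_diff P1 q1 poly_pcompose \<beta>_def)
  have "order 0 g \<noteq> 1"
  proof
    assume "order 0 g = 1"
    then have "g = [:0, 1:] * r" using r by simp
    then have "pderiv g = [:0, 1:] * pderiv r + r" by (simp add: pderiv_mult pderiv_pCons)
    then show False using g1 r0 by simp
  qed
  with k0 obtain k where k: "order 0 g = k + 2"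
    by (metis One_nat_def add_2_eq_Suc' not0_implies_Suc)
  define X :: "real poly" where "X = [:0, 1:]"
  have X1: "pderiv X = 1" and Xp: "poly X u = u" for u by (simp_all add: X_def pderiv_pCons)
  have g: "g = X ^ Suc (Suc k) * r" using r k by (simp add: X_def)
  define G1 where "G1 = smult (real (k + 2)) r + X * pderiv r"
  define G2 where "G2 = smult (real (k + 1)) G1 + X * pderiv G1"
  have "pderiv g = X ^ Suc k * G1"
    unfolding g G1_def pderiv_mult pderiv_power_Suc X1 by (simp add: algebra_simps smult_add_left)
  moreover from this have "pderiv (pderiv g) = X ^ k * G2"
    unfolding G2_def by (simp only: pderiv_mult pderiv_power_Suc X1) (simp add: algebra_simps smult_add_left)
  ultimately have gd: "poly g u = u ^ k * (u\<^sup>2 * poly r u)" "poly (pderiv g) u = u ^ k * (u * poly G1 u)"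
    "poly (pderiv (pderiv g)) u = u ^ k * poly G2 u" for u
    by (simp_all add: g Xp power2_eq_square)
  \<comment> \<open>the cofactor of \<open>u ^ k\<close> in the Hessian determinant; only the term with \<open>P G2\<close> survives at \<open>u = 0\<close>\<close>
  define T where "T = (\<lambda>u. (real m - 1) * (real m * (poly P u * poly G2 u
     + u\<^sup>2 * poly r u * poly (pderiv (pderiv P)) u + u ^ k * u\<^sup>2 * poly r u * poly G2 u)
     - (real m - 1) * (2 * poly (pderiv P) u * (u * poly G1 u) + u ^ k * (u * poly G1 u)\<^sup>2)))"
  have HT: "hessian_det \<Phi> (vector [1, l + u]) = u ^ k * T u" for u
  proof -
    have expand: "real m * poly q u * poly (pderiv (pderiv q)) u - (real m - 1) * (poly (pderiv q) u)\<^sup>2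
       = (real m * poly P u * poly (pderiv (pderiv P)) u - (real m - 1) * (poly (pderiv P) u)\<^sup>2)
       + real m * (poly P u * poly (pderiv (pderiv g)) u + poly g u * poly (pderiv (pderiv P)) u
          + poly g u * poly (pderiv (pderiv g)) u)
       - (real m - 1) * (2 * poly (pderiv P) u * poly (pderiv g) u + (poly (pderiv g) u)\<^sup>2)"
      unfolding gq pderiv_add poly_add by (simp add: algebra_simps power2_eq_square)
    show ?thesis
      unfolding Hq expand HP gd T_def by (simp add: algebra_simps power2_eq_square)
  qed
  have T0: "T 0 \<noteq> 0"
    using \<phi> m r0 by (simp add: T_def P0 G2_def G1_def Xp)
  have "\<omega> l = k"
  proof (rule vanishing_order_unique)
    show "isCont T 0" unfolding T_def by (intro continuous_intros)
    show "u ^ \<omega> l * S u = u ^ k * T u" for u using S HT by simp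
  qed (use Scont S0 T0 in auto)
  have "degree q \<le> m" using deg by (simp add: q_def degree_pcompose)
  moreover have "degree P \<le> m"
    unfolding P_def by (rule order_trans[OF degree_smult_le], rule order_trans[OF degree_power_le]) simp
  ultimately have "degree g \<le> m" unfolding g_def by (rule degree_diff_le)
  moreover have "degree g = k + 2 + degree r"
    using \<open>g \<noteq> 0\<close> unfolding g X_def by (subst degree_mult_eq) (auto simp: degree_power_eq)
  ultimately have "\<omega> l + 2 \<le> m" using \<open>\<omega> l = k\<close> by simp
  moreover have "\<Phi> (vector [1, l + u]) = \<phi> * (1 + \<beta> * u) ^ m + u ^ (\<omega> l + 2) * poly r u" for u
    using arg_cong[OF gq, of "\<lambda>f. poly f u"] gd(1)[of u] \<open>\<omega> l = k\<close>
    by (simp add: p q P0 power2_eq_square mult_ac)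
  ultimately show thesis using \<phi> that by blast
qed

section \<open>The sector of the surface\<close>

lemma abs_monomial_diff_le:
  fixes a b c d :: real
  assumes "\<bar>a\<bar> \<le> 1" "\<bar>b\<bar> \<le> 1" "\<bar>c\<bar> \<le> 1" "\<bar>d\<bar> \<le> 1"
  shows "\<bar>a ^ i * b ^ j - c ^ i * d ^ j\<bar> \<le> (real i + real j) * max \<bar>a - c\<bar> \<bar>b - d\<bar>"
proof -
  have 1: "\<bar>a ^ i - c ^ i\<bar> \<le> real i * \<bar>a - c\<bar>" and 2: "\<bar>b ^ j - d ^ j\<bar> \<le> real j * \<bar>b - d\<bar>"
    using norm_power_diff[of a c i] norm_power_diff[of b d j] assms by simp_all
  have "a ^ i * b ^ j - c ^ i * d ^ j = (a ^ i - c ^ i) * b ^ j + c ^ i * (b ^ j - d ^ j)"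
    by (simp add: algebra_simps)
  then have "\<bar>a ^ i * b ^ j - c ^ i * d ^ j\<bar> \<le> \<bar>a ^ i - c ^ i\<bar> * \<bar>b ^ j\<bar> + \<bar>c ^ i\<bar> * \<bar>b ^ j - d ^ j\<bar>"
    by (metis abs_mult abs_triangle_ineq)
  also have "\<dots> \<le> \<bar>a ^ i - c ^ i\<bar> * 1 + 1 * \<bar>b ^ j - d ^ j\<bar>"
    using assms by (intro add_mono mult_mono) (auto simp: power_abs power_le_one)
  also have "\<dots> \<le> real i * max \<bar>a - c\<bar> \<bar>b - d\<bar> + real j * max \<bar>a - c\<bar> \<bar>b - d\<bar>"
    using 1 2 by (intro add_mono) (simp; erule order_trans; intro mult_left_mono; simp)+
  finally show ?thesis by (simp add: algebra_simps)
qed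

lemma bin_poly_lipschitz:
  obtains L where "0 \<le> L" "\<And>x z. (\<And>i. \<bar>x $ i\<bar> \<le> 1) \<Longrightarrow> (\<And>i. \<bar>z $ i\<bar> \<le> 1) \<Longrightarrow>
    \<bar>bin_poly d a k e x - bin_poly d a k e z\<bar> \<le> L * max \<bar>x$1 - z$1\<bar> \<bar>x$2 - z$2\<bar>"
proof
  let ?L = "\<Sum>i\<le>d. \<bar>a i\<bar> * (real (k i) + real (e i))"
  show "0 \<le> ?L" by (intro sum_nonneg) auto
  fix x z :: "real^2" assume x: "\<And>i. \<bar>x $ i\<bar> \<le> 1" and z: "\<And>i. \<bar>z $ i\<bar> \<le> 1"
  have "\<bar>bin_poly d a k e x - bin_poly d a k e z\<bar>
      = \<bar>\<Sum>i\<le>d. a i * ((x$1) ^ k i * (x$2) ^ e i - (z$1) ^ k i * (z$2) ^ e i)\<bar>"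
    by (simp add: bin_poly_def sum_subtractf algebra_simps)
  also have "\<dots> \<le> (\<Sum>i\<le>d. \<bar>a i * ((x$1) ^ k i * (x$2) ^ e i - (z$1) ^ k i * (z$2) ^ e i)\<bar>)"
    by (rule sum_abs)
  also have "\<dots> \<le> (\<Sum>i\<le>d. \<bar>a i\<bar> * (real (k i) + real (e i)) * max \<bar>x$1 - z$1\<bar> \<bar>x$2 - z$2\<bar>)"
    unfolding abs_mult mult.assoc
    by (intro sum_mono mult_left_mono abs_monomial_diff_le x z) auto
  finally show "\<bar>bin_poly d a k e x - bin_poly d a k e z\<bar> \<le> ?L * max \<bar>x$1 - z$1\<bar> \<bar>x$2 - z$2\<bar>"
    by (simp add: sum_distrib_right)
qed

text \<open>The radius \<open>1/2\<close> leaves room to round a point of the patch to a nearby grid point and still have coordinates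
  of modulus at most \<open>1\<close>, where all powers are Lipschitz with an explicit constant.\<close>

locale sector_patch =
  fixes m :: nat and c :: real and \<Phi> :: "real^2 \<Rightarrow> real" and \<epsilon> :: real and U :: "(real^2) set"
    and l :: real
  assumes m: "2 \<le> m" and hom: "homogeneous_poly m \<Phi>" and \<epsilon>: "0 < \<epsilon>"
    and U: "open U" "0 \<in> U" "U \<subseteq> ball 0 (1 / 2)"
begin

abbreviation "g \<equiv> \<lambda>x. \<Phi> x + c"
abbreviation "D \<equiv> Gamma_sector \<epsilon> l \<inter> U"

lemma continuous_\<Phi>: "continuous_on S \<Phi>"
  using hom unfolding homogeneous_poly_iff_bin_poly by (auto intro: continuous_bin_poly)

lemma vector_1_l_nonzero: "(vector [1, l] :: real^2) \<noteq> 0"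
  by (simp add: vec_eq_iff forall_2)

lemma open_D: "open D"
  unfolding Gamma_sector_def using U open_sector[OF vector_1_l_nonzero] by blast

lemma D_subset: "x \<in> D \<Longrightarrow> \<bar>x $ i\<bar> < 1 / 2"
  using U(3) component_le_norm_cart[of x i] by (force simp: mem_ball)

sublocale graph_patch g D
proof
  obtain a where F: "\<Phi> = bin_poly m a (\<lambda>i. i) (\<lambda>i. m - i)"
    using hom homogeneous_poly_iff_bin_poly by blast
  show "g \<in> borel_measurable borel"
    by (intro borel_measurable_continuous_onI continuous_intros continuous_\<Phi>)
  have c1: "continuous_on S (partial 1 g)" and c2: "continuous_on S (partial 2 g)" for S
    unfolding F partial_bin_poly by (rule continuous_bin_poly)+
  show "partial 1 g \<in> borel_measurable borel" "partial 2 g \<in> borel_measurable borel"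
    using c1 c2 by (auto intro: borel_measurable_continuous_onI)
  show "D \<in> sets borel" by (intro borel_open open_D)
  have sub: "D \<subseteq> cball 0 1" using U(3) by (auto simp: subset_iff)
  then have "bounded D" using bounded_subset bounded_cball by blast
  then show "emeasure lborel D < \<infinity>" by (rule emeasure_bounded_finite)
  have "compact ((\<lambda>x. sqrt (1 + (partial 1 g x)\<^sup>2 + (partial 2 g x)\<^sup>2)) ` cball 0 1)"
    by (intro compact_continuous_image continuous_intros c1 c2 compact_cball)
  then have "bdd_above ((\<lambda>x. sqrt (1 + (partial 1 g x)\<^sup>2 + (partial 2 g x)\<^sup>2)) ` cball 0 1)"
    by (intro bounded_imp_bdd_above compact_imp_bounded)
  then show "bdd_above ((\<lambda>x. sqrt (1 + (partial 1 g x)\<^sup>2 + (partial 2 g x)\<^sup>2)) ` D)"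
    using sub by (meson bdd_above_mono image_mono)
qed

text \<open>Sectors are invariant under positive dilations, so one square around \<open>(1, l)\<close> inside the sector provides squares
  around \<open>(\<rho>, \<rho> l)\<close>, of side proportional to \<open>\<rho>\<close>, for all small \<open>\<rho>\<close>.\<close>

lemma square_subset_D:
  obtains \<eta> \<rho>0 where "0 < \<eta>" "\<eta> \<le> 1 / 2" "0 < \<rho>0" "\<rho>0 \<le> 1 / 2"
    "\<And>\<rho> x. 0 < \<rho> \<Longrightarrow> \<rho> \<le> \<rho>0 \<Longrightarrow> \<bar>x$1 - \<rho>\<bar> \<le> \<rho> * \<eta> \<Longrightarrow> \<bar>x$2 - \<rho> * l\<bar> \<le> \<rho> * \<eta> \<Longrightarrow> x \<in> D"
proof -
  define e :: "real^2" where "e = vector [1, l]"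
  have "e \<in> Gamma_sector \<epsilon> l" "open (Gamma_sector \<epsilon> l)"
    unfolding Gamma_sector_def e_def
    using self_in_sector[OF vector_1_l_nonzero \<epsilon>] open_sector[OF vector_1_l_nonzero] by auto
  then obtain r where r: "0 < r" "ball e r \<subseteq> Gamma_sector \<epsilon> l"
    by (meson open_contains_ball)
  obtain s where s: "0 < s" "ball 0 s \<subseteq> U" using U by (meson open_contains_ball)
  have norm2: "norm z \<le> \<bar>z$1\<bar> + \<bar>z$2\<bar>" for z :: "real^2"
    using norm_le_l1_cart[of z] by (simp add: sum_2)
  define \<eta> where "\<eta> = min (1 / 2) (r / 4)"
  define \<rho>0 where "\<rho>0 = min (1 / 2) (s / (\<bar>l\<bar> + 3))"
  show thesis
  proof
    have "0 < s / (\<bar>l\<bar> + 3)" using s by (intro divide_pos_pos) auto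
    then show "0 < \<eta>" "0 < \<rho>0" using r by (auto simp: \<eta>_def \<rho>0_def)
    show "\<eta> \<le> 1 / 2" "\<rho>0 \<le> 1 / 2" unfolding \<eta>_def \<rho>0_def by (rule min.cobounded1)+
    fix \<rho> and x :: "real^2"
    assume \<rho>: "0 < \<rho>" "\<rho> \<le> \<rho>0" and x: "\<bar>x$1 - \<rho>\<bar> \<le> \<rho> * \<eta>" "\<bar>x$2 - \<rho> * l\<bar> \<le> \<rho> * \<eta>"
    have dx: "norm (x - \<rho> *\<^sub>R e) \<le> \<rho> * (2 * \<eta>)"
      using norm2[of "x - \<rho> *\<^sub>R e"] x by (simp add: e_def)
    define z where "z = (1 / \<rho>) *\<^sub>R x"
    have xz: "x = \<rho> *\<^sub>R z" using \<rho> by (simp add: z_def)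
    have "x - \<rho> *\<^sub>R e = \<rho> *\<^sub>R (z - e)" by (simp add: xz algebra_simps)
    then have "norm (z - e) \<le> 2 * \<eta>" using dx \<rho> by simp
    also have "\<dots> < r" using r by (auto simp: \<eta>_def min_def)
    finally have "z \<in> Gamma_sector \<epsilon> l" using r by (auto simp: dist_norm norm_minus_commute)
    then have "x \<in> Gamma_sector \<epsilon> l"
      unfolding xz Gamma_sector_def using \<rho> by (intro scaleR_in_sector)
    moreover have "norm x < s"
    proof -
      have "norm x \<le> norm (\<rho> *\<^sub>R e) + norm (x - \<rho> *\<^sub>R e)"
        using norm_triangle_ineq[of "\<rho> *\<^sub>R e" "x - \<rho> *\<^sub>R e"] by simp
      also have "\<dots> \<le> \<rho> * (1 + \<bar>l\<bar>) + \<rho> * 1"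
      proof (rule add_mono)
        show "norm (\<rho> *\<^sub>R e) \<le> \<rho> * (1 + \<bar>l\<bar>)" using norm2[of e] \<rho> by (simp add: e_def)
        have "2 * \<eta> \<le> 1" by (simp add: \<eta>_def min_def)
        then have "\<rho> * (2 * \<eta>) \<le> \<rho> * 1" using \<rho> by (intro mult_left_mono) auto
        then show "norm (x - \<rho> *\<^sub>R e) \<le> \<rho> * 1" using dx by linarith
      qed
      also have "\<dots> < \<rho> * (\<bar>l\<bar> + 3)" using \<rho> by (simp add: algebra_simps)
      also have "\<dots> \<le> s / (\<bar>l\<bar> + 3) * (\<bar>l\<bar> + 3)"
        using \<rho> by (intro mult_right_mono) (auto simp: \<rho>0_def)
      finally show ?thesis by simp
    qed
    ultimately show "x \<in> D" using s by auto
  qed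
qed

end

section \<open>Large cubes, neighbourhoods of the surface, and the flat point at the origin\<close>

locale bounded_sector_patch = sector_patch +
  fixes p q :: ennreal
  assumes pq: "1 \<le> p" "1 \<le> q"
    and bounded: "Lp_Lq_bounded p q (local_maximal (sigma_measure \<Phi> c \<epsilon> U l))"
begin

definition "inv_p = enn2real (1 / p)"
definition "inv_q = enn2real (1 / q)"

lemma bounded_graph: "Lp_Lq_bounded p q (local_maximal (graph_surface_measure g D))"
  using bounded by (simp add: sigma_measure_def)

lemmas test = scaling_test_nat[OF pq bounded_graph, folded inv_p_def inv_q_def]

lemma fixed_box_in_D:
  obtains a B where "0 < a" "B \<in> sets borel" "B \<subseteq> D" "ennreal a \<le> emeasure lborel B"
proof -
  obtain \<eta> \<rho>0 where \<eta>: "0 < \<eta>" "0 < \<rho>0"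
    and sub: "\<And>\<rho> x. 0 < \<rho> \<Longrightarrow> \<rho> \<le> \<rho>0 \<Longrightarrow> \<bar>x$1 - \<rho>\<bar> \<le> \<rho> * \<eta> \<Longrightarrow> \<bar>x$2 - \<rho> * l\<bar> \<le> \<rho> * \<eta> \<Longrightarrow> x \<in> D"
    using square_subset_D by metis
  let ?B = "{x :: real^2. \<bar>x$1 - \<rho>0\<bar> \<le> \<rho>0 * \<eta> \<and> \<bar>x$2 - \<rho>0 * l\<bar> \<le> \<rho>0 * \<eta>}"
  have B: "?B \<in> sets borel" "emeasure lborel ?B = ennreal (4 * (\<rho>0 * \<eta>) * (\<rho>0 * \<eta>))"
    using emeasure_skew_box_2[of "\<rho>0 * \<eta>" "\<rho>0 * \<eta>" 0 0 \<rho>0 "\<rho>0 * l"] \<eta> by simp_all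
  show thesis
    by (rule that[of "4 * (\<rho>0 * \<eta>) * (\<rho>0 * \<eta>)" ?B]) (use B \<eta> sub in auto)
qed

lemma \<Phi>_bounded:
  obtains K where "1 \<le> K" "\<And>z. norm z \<le> r \<Longrightarrow> \<bar>\<Phi> z\<bar> \<le> K"
proof -
  have "bounded (\<Phi> ` cball 0 r)"
    by (intro compact_imp_bounded compact_continuous_image continuous_\<Phi> compact_cball)
  then obtain K where K: "\<forall>z\<in>cball 0 r. \<bar>\<Phi> z\<bar> \<le> K"
    unfolding bounded_iff by auto
  show thesis by (rule that[of "max 1 K"]) (use K in \<open>auto simp: le_max_iff_disj\<close>)
qed

text \<open>For functions living at large scales the average acts like a multiple of the identity, which forces
  \<open>q \<ge> p\<close>: \<open>E\<close> and \<open>F\<close> are cubes of side comparable to \<open>1/\<rho>\<close>.\<close>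

lemma test_large_cubes: "inv_q \<le> inv_p"
proof -
  obtain a B where B: "0 < a" "B \<in> sets borel" "B \<subseteq> D" "ennreal a \<le> emeasure lborel B"
    by (rule fixed_box_in_D)
  obtain K where K: "1 \<le> K" "\<And>z. norm z \<le> 1 \<Longrightarrow> \<bar>\<Phi> z\<bar> \<le> K" using \<Phi>_bounded[of 1] by metis
  define k where "k = 1 + K + \<bar>c\<bar>"
  have "(- 3) * inv_p \<le> 0 + (- 3) * inv_q"
    unfolding inv_p_def inv_q_def
  proof (rule scaling_test[OF pq bounded_graph])
    show "0 < a" "0 < (8::real)" "0 < 8 * k ^ 3" "0 < (1::real)" using B K by (auto simp: k_def)
    fix \<rho> :: real assume \<rho>: "0 < \<rho>" "\<rho> < 1"
    let ?E = "{v :: real^3. \<bar>v$1\<bar> \<le> 1 / \<rho> \<and> \<bar>v$2\<bar> \<le> 1 / \<rho> \<and> \<bar>v$3\<bar> \<le> 1 / \<rho>}"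
    let ?F = "{v :: real^3. \<bar>v$1\<bar> \<le> k / \<rho> \<and> \<bar>v$2\<bar> \<le> k / \<rho> \<and> \<bar>v$3\<bar> \<le> k / \<rho>}"
    have k: "0 \<le> k" using K by (simp add: k_def)
    have pw: "\<rho> powr (- 3) = 1 / \<rho> ^ 3" using \<rho> by (simp add: powr_minus_divide)
    have E: "?E \<in> sets borel" "emeasure lborel ?E = ennreal (8 * \<rho> powr (- 3))"
      using emeasure_skew_box_3[of "1 / \<rho>" "1 / \<rho>" "1 / \<rho>" 1 1 0 0 0 0 0 0 0] \<rho>
      by (simp_all add: pw power3_eq_cube mult.assoc)
    have F: "?F \<in> sets borel" "emeasure lborel ?F = ennreal (8 * k ^ 3 * \<rho> powr (- 3))"
      using emeasure_skew_box_3[of "k / \<rho>" "k / \<rho>" "k / \<rho>" 1 1 0 0 0 0 0 0 0] \<rho> k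
      by (simp_all add: pw power3_eq_cube mult.assoc)
    have "v - 1 *\<^sub>R graph_point g z \<in> ?F" if v: "v \<in> ?E" and z: "z \<in> B" for v z
    proof -
      have "z \<in> D" using z B by blast
      then have z1: "\<bar>z$1\<bar> < 1 / 2" "\<bar>z$2\<bar> < 1 / 2" and "norm z \<le> 1"
        using D_subset U(3) by (auto simp: mem_ball)
      then have g: "\<bar>g z\<bar> \<le> K + \<bar>c\<bar>" using K(2)[of z] by linarith
      have "1 / \<rho> + (K + \<bar>c\<bar>) * 1 \<le> 1 / \<rho> + (K + \<bar>c\<bar>) * (1 / \<rho>)"
        using \<rho> K by (intro add_left_mono mult_left_mono) auto
      then have le: "1 / \<rho> + (K + \<bar>c\<bar>) \<le> k / \<rho>" by (simp add: k_def add_divide_distrib)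
      have b: "\<bar>v$1\<bar> \<le> 1 / \<rho>" "\<bar>v$2\<bar> \<le> 1 / \<rho>" "\<bar>v$3\<bar> \<le> 1 / \<rho>" using v by auto
      have "\<bar>v$1 - z$1\<bar> \<le> 1 / \<rho> + (K + \<bar>c\<bar>)" "\<bar>v$2 - z$2\<bar> \<le> 1 / \<rho> + (K + \<bar>c\<bar>)"
        "\<bar>v$3 - g z\<bar> \<le> 1 / \<rho> + (K + \<bar>c\<bar>)"
        using b z1 g K(1) by linarith+
      then show ?thesis using le by simp
    qed
    then show "\<exists>E F. E \<in> sets borel \<and> F \<in> sets borel \<and>
      ennreal (8 * \<rho> powr (- 3)) \<le> emeasure lborel E \<and>
      emeasure lborel F \<le> ennreal (8 * k ^ 3 * \<rho> powr (- 3)) \<and>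
      (\<forall>y\<in>E. \<exists>t\<in>{1..2}. \<exists>B\<in>sets borel. B \<subseteq> D \<and> ennreal (a * \<rho> powr 0) \<le> emeasure lborel B \<and>
         (\<forall>x\<in>B. y - t *\<^sub>R graph_point g x \<in> F))"
      using E F B \<rho>
      by (intro exI[of _ ?E] exI[of _ ?F] conjI ballI bexI[of _ 1] bexI[of _ B]) auto
  qed
  then show ?thesis by simp
qed

text \<open>Take for \<open>F\<close> the \<open>\<rho>\<close>-neighbourhood of the reflected surface, of measure about \<open>\<rho>\<close>, and for \<open>E\<close> a cube of
  side \<open>\<rho>\<close>. To bound the measure of the neighbourhood it is covered by about \<open>\<rho>^(-2)\<close> cubes of side
  comparable to \<open>\<rho>\<close> centred at points of the graph over a grid.\<close>

lemma test_surface_neighbourhood: "inv_p \<le> 3 * inv_q"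
proof -
  obtain a B where B: "0 < a" "B \<in> sets borel" "B \<subseteq> D" "ennreal a \<le> emeasure lborel B"
    by (rule fixed_box_in_D)
  obtain b where \<Phi>: "\<Phi> = bin_poly m b (\<lambda>i. i) (\<lambda>i. m - i)"
    using hom homogeneous_poly_iff_bin_poly by blast
  obtain L where L: "0 \<le> L" "\<And>w z. (\<And>i. \<bar>w $ i\<bar> \<le> 1) \<Longrightarrow> (\<And>i. \<bar>z $ i\<bar> \<le> 1) \<Longrightarrow>
      \<bar>\<Phi> w - \<Phi> z\<bar> \<le> L * max \<bar>w$1 - z$1\<bar> \<bar>w$2 - z$2\<bar>"
    using bin_poly_lipschitz[of m b "\<lambda>i. i" "\<lambda>i. m - i"] unfolding \<Phi> by blast
  have "real 1 * inv_p \<le> real 0 + real 3 * inv_q"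
  proof (rule test)
    show "0 < a" "0 < (8::real)" "0 < 25 * (32 * (1 + L))" "0 < (1 / 2 :: real)" using B L by auto
    fix \<rho> :: real assume \<rho>: "0 < \<rho>" "\<rho> < 1 / 2"
    \<comment> \<open>enough grid points of mesh \<open>\<rho>\<close> to cover \<open>[-1, 1]\<close>\<close>
    define N where "N = nat \<lceil>1 / \<rho>\<rceil>"
    have N: "1 / \<rho> \<le> real N" "real N \<le> 1 / \<rho> + 1"
      using \<rho> by (auto simp: N_def)
    define I where "I = {- int N..int N} \<times> {- int N..int N}"
    define P :: "int \<times> int \<Rightarrow> real^2" where "P = (\<lambda>k. vector [\<rho> * of_int (fst k), \<rho> * of_int (snd k)])"
    define box where "box = (\<lambda>k. {v :: real^3. \<bar>v$1 - (- P k $ 1)\<bar> \<le> 2 * \<rho> \<and>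
       \<bar>v$2 - (- P k $ 2)\<bar> \<le> 2 * \<rho> \<and> \<bar>v$3 - (- g (P k))\<bar> \<le> (1 + L) * \<rho>})"
    let ?E = "{v :: real^3. \<bar>v$1\<bar> \<le> \<rho> \<and> \<bar>v$2\<bar> \<le> \<rho> \<and> \<bar>v$3\<bar> \<le> \<rho>}"
    let ?F = "\<Union>k\<in>I. box k"
    have E: "?E \<in> sets borel" "emeasure lborel ?E = ennreal (8 * \<rho> ^ 3)"
      using emeasure_skew_box_3[of \<rho> \<rho> \<rho> 1 1 0 0 0 0 0 0 0] \<rho>
      by (simp_all add: power3_eq_cube mult.assoc)
    have box: "box k \<in> sets borel" "emeasure lborel (box k) = ennreal (32 * (1 + L) * \<rho> ^ 3)" for k
      using emeasure_skew_box_3[of "2 * \<rho>" "2 * \<rho>" "(1 + L) * \<rho>" 1 1 0 0 0 0 "- P k $ 1" "- P k $ 2" "- g (P k)"] \<rho> L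
      by (simp_all add: box_def power3_eq_cube mult_ac)
    have "finite I" by (simp add: I_def)
    have "real (card I) = (2 * real N + 1)\<^sup>2"
      by (simp add: I_def card_cartesian_product power2_eq_square)
    also have "\<dots> \<le> (5 / \<rho>)\<^sup>2"
    proof (rule power_mono)
      have "3 \<le> 3 / \<rho>" using \<rho> by (simp add: field_simps)
      then show "2 * real N + 1 \<le> 5 / \<rho>" using N(2) by simp
    qed simp
    finally have card: "real (card I) \<le> 25 / \<rho>\<^sup>2" by (simp add: power_divide)
    have F: "?F \<in> sets borel" using box(1) \<open>finite I\<close> by auto
    have "emeasure lborel ?F \<le> (\<Sum>k\<in>I. emeasure lborel (box k))"
      using box(1) \<open>finite I\<close> by (intro emeasure_subadditive_finite) auto
    also have "\<dots> = ennreal (real (card I) * (32 * (1 + L) * \<rho> ^ 3))"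
      using \<rho> L by (simp add: box(2) ennreal_mult ennreal_of_nat_eq_real_of_nat)
    also have "\<dots> \<le> ennreal (25 * (32 * (1 + L)) * \<rho> ^ 1)"
    proof (rule ennreal_leI)
      have "real (card I) * (32 * (1 + L) * \<rho> ^ 3) \<le> 25 / \<rho>\<^sup>2 * (32 * (1 + L) * \<rho> ^ 3)"
        using card \<rho> L by (intro mult_right_mono) auto
      also have "\<dots> = 25 * (32 * (1 + L)) * \<rho> ^ 1"
        using \<rho> by (simp add: power2_eq_square power3_eq_cube)
      finally show "real (card I) * (32 * (1 + L) * \<rho> ^ 3) \<le> 25 * (32 * (1 + L)) * \<rho> ^ 1" .
    qed
    finally have F': "emeasure lborel ?F \<le> ennreal (25 * (32 * (1 + L)) * \<rho> ^ 1)" .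
    have "v - 1 *\<^sub>R graph_point g z \<in> ?F" if v: "v \<in> ?E" and z: "z \<in> B" for v z
    proof -
      have zD: "z \<in> D" using z B by blast
      define k where "k = (\<lfloor>z$1 / \<rho>\<rfloor>, \<lfloor>z$2 / \<rho>\<rfloor>)"
      have fl: "\<lfloor>z$i / \<rho>\<rfloor> \<in> {- int N..int N} \<and> \<bar>z$i - \<rho> * of_int \<lfloor>z$i / \<rho>\<rfloor>\<bar> \<le> \<rho>" for i
      proof -
        define f where "f = \<lfloor>z$i / \<rho>\<rfloor>"
        have f: "of_int f \<le> z$i / \<rho>" "z$i / \<rho> < of_int f + 1" by (simp_all add: f_def)
        have "\<bar>z$i / \<rho>\<bar> < 1 / \<rho>" using D_subset[OF zD, of i] \<rho> by (simp add: divide_simps)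
        then have "\<bar>z$i / \<rho>\<bar> < real N" using N(1) by linarith
        then have "real_of_int f < real N" "- real N < real_of_int f + 1" using f by linarith+
        then have "f \<in> {- int N..int N}" by auto
        moreover have "\<rho> * of_int f \<le> z$i" "z$i \<le> \<rho> * of_int f + \<rho>"
          using f \<rho> by (auto simp: field_simps)
        ultimately show ?thesis using \<rho> by (auto simp: f_def[symmetric])
      qed
      have kI: "k \<in> I" using fl[of 1] fl[of 2] by (simp add: I_def k_def)
      have dz: "\<bar>z$1 - P k $ 1\<bar> \<le> \<rho>" "\<bar>z$2 - P k $ 2\<bar> \<le> \<rho>"
        using fl[of 1] fl[of 2] by (simp_all add: P_def k_def)
      have z1: "\<bar>z $ i\<bar> \<le> 1" for i using D_subset[OF zD, of i] by linarith
      have P1: "\<bar>P k $ i\<bar> \<le> 1" for i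
        using D_subset[OF zD, of 1] D_subset[OF zD, of 2] dz \<rho> exhaust_2[of i] by auto
      have "\<bar>\<Phi> z - \<Phi> (P k)\<bar> \<le> L * max \<bar>z$1 - P k $ 1\<bar> \<bar>z$2 - P k $ 2\<bar>"
        by (rule L(2)) (use z1 P1 in auto)
      also have "\<dots> \<le> L * \<rho>" using dz L by (intro mult_left_mono) auto
      finally have "\<bar>\<Phi> z - \<Phi> (P k)\<bar> \<le> L * \<rho>" .
      moreover have "\<bar>v$1\<bar> \<le> \<rho>" "\<bar>v$2\<bar> \<le> \<rho>" "\<bar>v$3\<bar> \<le> \<rho>" using v by auto
      ultimately have "\<bar>v$1 - z$1 - (- P k $ 1)\<bar> \<le> 2 * \<rho>" "\<bar>v$2 - z$2 - (- P k $ 2)\<bar> \<le> 2 * \<rho>"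
        "\<bar>v$3 - g z - (- g (P k))\<bar> \<le> \<rho> + L * \<rho>"
        using dz by linarith+
      then have "v - 1 *\<^sub>R graph_point g z \<in> box k" by (simp add: box_def distrib_right)
      then show ?thesis using kI by blast
    qed
    then show "\<exists>E F. E \<in> sets borel \<and> F \<in> sets borel \<and>
      ennreal (8 * \<rho> ^ 3) \<le> emeasure lborel E \<and>
      emeasure lborel F \<le> ennreal (25 * (32 * (1 + L)) * \<rho> ^ 1) \<and>
      (\<forall>y\<in>E. \<exists>t\<in>{1..2}. \<exists>B\<in>sets borel. B \<subseteq> D \<and> ennreal (a * \<rho> ^ 0) \<le> emeasure lborel B \<and>
         (\<forall>x\<in>B. y - t *\<^sub>R graph_point g x \<in> F))"
      using E F F' B
      by (intro exI[of _ ?E] exI[of _ ?F] conjI ballI bexI[of _ 1] bexI[of _ B]) auto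
  qed
  then show ?thesis by simp
qed

text \<open>Over a square of side \<open>\<rho>\<close> near the origin \<open>\<Phi>\<close> is of size \<open>\<rho>^m\<close> by homogeneity, so the surface stays in a box
  of dimensions \<open>\<rho>\<close>, \<open>\<rho>\<close>, \<open>\<rho>^m\<close>.\<close>

lemma box_at_origin:
  obtains a d \<rho>0 where "0 < a" "0 < d" "0 < \<rho>0"
    "\<And>\<rho>. 0 < \<rho> \<Longrightarrow> \<rho> < \<rho>0 \<Longrightarrow> \<exists>B F. B \<in> sets borel \<and> B \<subseteq> D \<and> ennreal (a * \<rho> ^ 2) \<le> emeasure lborel B \<and>
      F \<in> sets borel \<and> emeasure lborel F \<le> ennreal (d * \<rho> ^ (m + 2)) \<and>
      (\<forall>t\<in>{1..2}. \<forall>v. \<bar>v$1\<bar> \<le> \<rho> \<longrightarrow> \<bar>v$2\<bar> \<le> \<rho> \<longrightarrow> \<bar>v$3 - t * c\<bar> \<le> \<rho> ^ m \<longrightarrow>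
         (\<forall>z\<in>B. v - t *\<^sub>R graph_point g z \<in> F))"
proof -
  obtain \<eta> \<rho>0 where \<eta>: "0 < \<eta>" "\<eta> \<le> 1 / 2" "0 < \<rho>0"
    and sub: "\<And>\<rho> x. 0 < \<rho> \<Longrightarrow> \<rho> \<le> \<rho>0 \<Longrightarrow> \<bar>x$1 - \<rho>\<bar> \<le> \<rho> * \<eta> \<Longrightarrow> \<bar>x$2 - \<rho> * l\<bar> \<le> \<rho> * \<eta> \<Longrightarrow> x \<in> D"
    using square_subset_D by metis
  define k where "k = \<bar>l\<bar> + 2"
  have k: "2 \<le> k" by (simp add: k_def)
  obtain K where K: "1 \<le> K" "\<And>z. norm z \<le> 2 * k \<Longrightarrow> \<bar>\<Phi> z\<bar> \<le> K" using \<Phi>_bounded[of "2 * k"] by metis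
  show thesis
  proof (rule that)
    show "0 < 4 * \<eta>\<^sup>2" "0 < 24 * (2 * k + 1)\<^sup>2 * K" "0 < \<rho>0" using \<eta> k K by auto
    fix \<rho> :: real assume \<rho>: "0 < \<rho>" "\<rho> < \<rho>0"
    let ?B = "{z :: real^2. \<bar>z$1 - \<rho>\<bar> \<le> \<rho> * \<eta> \<and> \<bar>z$2 - \<rho> * l\<bar> \<le> \<rho> * \<eta>}"
    let ?F = "{v :: real^3. \<bar>v$1\<bar> \<le> (2 * k + 1) * \<rho> \<and> \<bar>v$2\<bar> \<le> (2 * k + 1) * \<rho> \<and> \<bar>v$3\<bar> \<le> 3 * K * \<rho> ^ m}"
    have B: "?B \<in> sets borel" "emeasure lborel ?B = ennreal (4 * \<eta>\<^sup>2 * \<rho> ^ 2)"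
      using emeasure_skew_box_2[of "\<rho> * \<eta>" "\<rho> * \<eta>" 0 0 \<rho> "\<rho> * l"] \<eta> \<rho>
      by (simp_all add: power2_eq_square mult_ac)
    have F: "?F \<in> sets borel" "emeasure lborel ?F = ennreal (24 * (2 * k + 1)\<^sup>2 * K * \<rho> ^ (m + 2))"
      using emeasure_skew_box_3[of "(2 * k + 1) * \<rho>" "(2 * k + 1) * \<rho>" "3 * K * \<rho> ^ m" 1 1 0 0 0 0 0 0 0] k K \<rho>
      by (simp_all add: power2_eq_square power_add mult_ac)
    have BD: "?B \<subseteq> D" using sub[of \<rho>] \<rho> by auto
    have mem: "v - t *\<^sub>R graph_point g z \<in> ?F"
      if t: "t \<in> {1..2}" and v: "\<bar>v$1\<bar> \<le> \<rho>" "\<bar>v$2\<bar> \<le> \<rho>" "\<bar>v$3 - t * c\<bar> \<le> \<rho> ^ m" and z: "z \<in> ?B"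
      for t z and v :: "real^3"
    proof -
      have "\<rho> * \<eta> \<le> \<rho> * 1" using \<eta> \<rho> by (intro mult_left_mono) auto
      then have "\<bar>z$1 - \<rho>\<bar> \<le> \<rho>" "\<bar>z$2 - \<rho> * l\<bar> \<le> \<rho>" using z by auto
      moreover have "k * \<rho> = \<bar>\<rho> * l\<bar> + 2 * \<rho>" "0 \<le> \<bar>\<rho> * l\<bar>" using \<rho> by (simp_all add: k_def abs_mult algebra_simps)
      ultimately have z: "\<bar>z$1\<bar> \<le> k * \<rho>" "\<bar>z$2\<bar> \<le> k * \<rho>" by linarith+
      define w where "w = (1 / \<rho>) *\<^sub>R z"
      have "\<bar>w$1\<bar> \<le> k" "\<bar>w$2\<bar> \<le> k" using z \<rho> by (auto simp: w_def field_simps)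
      then have "norm w \<le> 2 * k" using norm_le_l1_cart[of w] by (simp add: sum_2)
      moreover have "\<Phi> z = \<rho> ^ m * \<Phi> w"
        using homogeneous_poly_scaleR[OF hom, of \<rho> w] \<rho> by (simp add: w_def)
      ultimately have "\<bar>\<Phi> z\<bar> \<le> \<rho> ^ m * K" using K(2)[of w] \<rho> by (simp add: abs_mult)
      have tz: "\<bar>t * r\<bar> \<le> 2 * s" if "\<bar>r\<bar> \<le> s" for r s
        using t that by (auto simp: abs_mult intro!: mult_mono)
      have "\<bar>t * \<Phi> z\<bar> \<le> 2 * (\<rho> ^ m * K)" by (rule tz) fact
      moreover have "\<rho> ^ m * 1 \<le> \<rho> ^ m * K" using K \<rho> by (intro mult_left_mono) auto
      ultimately have "\<bar>v$3 - (t * c + t * \<Phi> z)\<bar> \<le> 3 * (\<rho> ^ m * K)"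
        using v(3) by linarith
      then have "\<bar>v$3 - t * (\<Phi> z + c)\<bar> \<le> 3 * K * \<rho> ^ m" by (simp add: algebra_simps)
      moreover have "\<bar>v$1 - t * z$1\<bar> \<le> \<rho> + 2 * (k * \<rho>)" "\<bar>v$2 - t * z$2\<bar> \<le> \<rho> + 2 * (k * \<rho>)"
        using tz[OF z(1)] tz[OF z(2)] v by linarith+
      ultimately show ?thesis by (simp add: algebra_simps)
    qed
    show "\<exists>B F. B \<in> sets borel \<and> B \<subseteq> D \<and> ennreal (4 * \<eta>\<^sup>2 * \<rho> ^ 2) \<le> emeasure lborel B \<and>
      F \<in> sets borel \<and> emeasure lborel F \<le> ennreal (24 * (2 * k + 1)\<^sup>2 * K * \<rho> ^ (m + 2)) \<and>
      (\<forall>t\<in>{1..2}. \<forall>v. \<bar>v$1\<bar> \<le> \<rho> \<longrightarrow> \<bar>v$2\<bar> \<le> \<rho> \<longrightarrow> \<bar>v$3 - t * c\<bar> \<le> \<rho> ^ m \<longrightarrow>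
         (\<forall>z\<in>B. v - t *\<^sub>R graph_point g z \<in> F))"
      using B(1) F(1) eq_refl[OF B(2)[symmetric]] eq_refl[OF F(2)] BD mem
      by (intro exI[of _ ?B] exI[of _ ?F] conjI ballI allI impI) blast+
  qed
qed

text \<open>When \<open>c \<noteq> 0\<close> the dilations move the flat piece vertically: \<open>t = v\<^sub>3 / c\<close> serves every height in an
  interval of fixed length, so \<open>E\<close> has measure about \<open>\<rho>^2\<close>.\<close>

lemma test_origin_box_translated:
  assumes c: "c \<noteq> 0"
  shows "real (m + 2) * inv_p \<le> 2 + 2 * inv_q"
proof -
  obtain a d \<rho>0 where pos: "0 < a" "0 < d" "0 < \<rho>0" and BF:
    "\<And>\<rho>. 0 < \<rho> \<Longrightarrow> \<rho> < \<rho>0 \<Longrightarrow> \<exists>B F. B \<in> sets borel \<and> B \<subseteq> D \<and> ennreal (a * \<rho> ^ 2) \<le> emeasure lborel B \<and>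
      F \<in> sets borel \<and> emeasure lborel F \<le> ennreal (d * \<rho> ^ (m + 2)) \<and>
      (\<forall>t\<in>{1..2}. \<forall>v. \<bar>v$1\<bar> \<le> \<rho> \<longrightarrow> \<bar>v$2\<bar> \<le> \<rho> \<longrightarrow> \<bar>v$3 - t * c\<bar> \<le> \<rho> ^ m \<longrightarrow>
         (\<forall>z\<in>B. v - t *\<^sub>R graph_point g z \<in> F))"
    by (rule box_at_origin) blast
  have "real (m + 2) * inv_p \<le> real 2 + real 2 * inv_q"
  proof (rule test)
    show "0 < a" "0 < 4 * \<bar>c\<bar>" "0 < d" "0 < \<rho>0" using pos c by auto
    fix \<rho> :: real assume \<rho>: "0 < \<rho>" "\<rho> < \<rho>0"
    obtain B F where B: "B \<in> sets borel" "B \<subseteq> D" "ennreal (a * \<rho> ^ 2) \<le> emeasure lborel B"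
      and F: "F \<in> sets borel" "emeasure lborel F \<le> ennreal (d * \<rho> ^ (m + 2))"
      and mem: "\<And>t v z. t \<in> {1..2} \<Longrightarrow> \<bar>v$1\<bar> \<le> \<rho> \<Longrightarrow> \<bar>v$2\<bar> \<le> \<rho> \<Longrightarrow> \<bar>v$3 - t * c\<bar> \<le> \<rho> ^ m \<Longrightarrow>
         z \<in> B \<Longrightarrow> v - t *\<^sub>R graph_point g z \<in> F"
      using BF[OF \<rho>] by blast
    let ?E = "{v :: real^3. \<bar>v$1\<bar> \<le> \<rho> \<and> \<bar>v$2\<bar> \<le> \<rho> \<and> \<bar>v$3 - 3 / 2 * c\<bar> \<le> \<bar>c\<bar> / 2}"
    have E: "?E \<in> sets borel" "emeasure lborel ?E = ennreal (4 * \<bar>c\<bar> * \<rho> ^ 2)"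
      using emeasure_skew_box_3[of \<rho> \<rho> "\<bar>c\<bar> / 2" 1 1 0 0 0 0 0 0 "3 / 2 * c"] \<rho>
      by (simp_all add: power2_eq_square mult_ac)
    have t: "v$3 / c \<in> {1..2}" if "v \<in> ?E" for v
    proof -
      have "\<bar>(v$3 - 3 / 2 * c) / c\<bar> \<le> 1 / 2"
        unfolding abs_divide using that c by (simp add: divide_le_eq)
      then have "\<bar>v$3 / c - 3 / 2\<bar> \<le> 1 / 2" using c by (simp add: diff_divide_distrib)
      then show ?thesis unfolding atLeastAtMost_iff by arith
    qed
    have "v - (v$3 / c) *\<^sub>R graph_point g z \<in> F" if "v \<in> ?E" "z \<in> B" for v z
      by (rule mem) (use t[OF that(1)] that c \<rho> in auto)
    then show "\<exists>E F. E \<in> sets borel \<and> F \<in> sets borel \<and>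
      ennreal (4 * \<bar>c\<bar> * \<rho> ^ 2) \<le> emeasure lborel E \<and> emeasure lborel F \<le> ennreal (d * \<rho> ^ (m + 2)) \<and>
      (\<forall>y\<in>E. \<exists>t\<in>{1..2}. \<exists>B\<in>sets borel. B \<subseteq> D \<and> ennreal (a * \<rho> ^ 2) \<le> emeasure lborel B \<and>
         (\<forall>x\<in>B. y - t *\<^sub>R graph_point g x \<in> F))"
      using E F B t
      by (intro exI[of _ ?E] exI[of _ F] conjI ballI bexI[of _ "_$3 / c"] bexI[of _ B]) simp_all
  qed
  then show ?thesis by simp
qed

text \<open>When \<open>c = 0\<close> the flat piece stays at the origin under dilations, and \<open>E\<close> is a box like \<open>F\<close>.\<close>

lemma test_origin_box:
  assumes c: "c = 0"
  shows "real (m + 2) * inv_p \<le> 2 + real (m + 2) * inv_q"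
proof -
  obtain a d \<rho>0 where pos: "0 < a" "0 < d" "0 < \<rho>0" and BF:
    "\<And>\<rho>. 0 < \<rho> \<Longrightarrow> \<rho> < \<rho>0 \<Longrightarrow> \<exists>B F. B \<in> sets borel \<and> B \<subseteq> D \<and> ennreal (a * \<rho> ^ 2) \<le> emeasure lborel B \<and>
      F \<in> sets borel \<and> emeasure lborel F \<le> ennreal (d * \<rho> ^ (m + 2)) \<and>
      (\<forall>t\<in>{1..2}. \<forall>v. \<bar>v$1\<bar> \<le> \<rho> \<longrightarrow> \<bar>v$2\<bar> \<le> \<rho> \<longrightarrow> \<bar>v$3 - t * c\<bar> \<le> \<rho> ^ m \<longrightarrow>
         (\<forall>z\<in>B. v - t *\<^sub>R graph_point g z \<in> F))"
    by (rule box_at_origin) blast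
  have "real (m + 2) * inv_p \<le> real 2 + real (m + 2) * inv_q"
  proof (rule test)
    show "0 < a" "0 < (8::real)" "0 < d" "0 < \<rho>0" using pos by auto
    fix \<rho> :: real assume \<rho>: "0 < \<rho>" "\<rho> < \<rho>0"
    obtain B F where B: "B \<in> sets borel" "B \<subseteq> D" "ennreal (a * \<rho> ^ 2) \<le> emeasure lborel B"
      and F: "F \<in> sets borel" "emeasure lborel F \<le> ennreal (d * \<rho> ^ (m + 2))"
      and mem: "\<And>t v z. t \<in> {1..2} \<Longrightarrow> \<bar>v$1\<bar> \<le> \<rho> \<Longrightarrow> \<bar>v$2\<bar> \<le> \<rho> \<Longrightarrow> \<bar>v$3 - t * c\<bar> \<le> \<rho> ^ m \<Longrightarrow>
         z \<in> B \<Longrightarrow> v - t *\<^sub>R graph_point g z \<in> F"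
      using BF[OF \<rho>] by blast
    let ?E = "{v :: real^3. \<bar>v$1\<bar> \<le> \<rho> \<and> \<bar>v$2\<bar> \<le> \<rho> \<and> \<bar>v$3\<bar> \<le> \<rho> ^ m}"
    have E: "?E \<in> sets borel" "emeasure lborel ?E = ennreal (8 * \<rho> ^ (m + 2))"
      using emeasure_skew_box_3[of \<rho> \<rho> "\<rho> ^ m" 1 1 0 0 0 0 0 0 0] \<rho>
      by (simp_all add: power2_eq_square power_add mult_ac)
    have "v - 1 *\<^sub>R graph_point g z \<in> F" if "v \<in> ?E" "z \<in> B" for v z
      by (rule mem) (use that c in auto)
    then show "\<exists>E F. E \<in> sets borel \<and> F \<in> sets borel \<and>
      ennreal (8 * \<rho> ^ (m + 2)) \<le> emeasure lborel E \<and> emeasure lborel F \<le> ennreal (d * \<rho> ^ (m + 2)) \<and>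
      (\<forall>y\<in>E. \<exists>t\<in>{1..2}. \<exists>B\<in>sets borel. B \<subseteq> D \<and> ennreal (a * \<rho> ^ 2) \<le> emeasure lborel B \<and>
         (\<forall>x\<in>B. y - t *\<^sub>R graph_point g x \<in> F))"
      using E F B
      by (intro exI[of _ ?E] exI[of _ F] conjI ballI bexI[of _ 1] bexI[of _ B]) auto
  qed
  then show ?thesis by simp
qed

end

section \<open>The neighbourhood of a degenerate line\<close>

lemma power_taylor2_le:
  fixes a b :: real
  assumes "\<bar>a\<bar> \<le> 1" "\<bar>b\<bar> \<le> 1"
  shows "\<bar>a ^ n - b ^ n - real n * b ^ (n - 1) * (a - b)\<bar> \<le> (real n)\<^sup>2 * (a - b)\<^sup>2"
proof (induction n)
  case 0
  then show ?case by simp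
next
  case (Suc n)
  have "a ^ Suc n - b ^ Suc n - real (Suc n) * b ^ (Suc n - 1) * (a - b)
      = a * (a ^ n - b ^ n - real n * b ^ (n - 1) * (a - b)) + real n * b ^ (n - 1) * (a - b)\<^sup>2"
    by (cases n) (simp_all add: algebra_simps power2_eq_square)
  also have "\<bar>\<dots>\<bar> \<le> \<bar>a\<bar> * \<bar>a ^ n - b ^ n - real n * b ^ (n - 1) * (a - b)\<bar> + real n * \<bar>b\<bar> ^ (n - 1) * (a - b)\<^sup>2"
    by (rule order_trans[OF abs_triangle_ineq]) (simp add: abs_mult power_abs)
  also have "\<dots> \<le> 1 * ((real n)\<^sup>2 * (a - b)\<^sup>2) + real n * 1 * (a - b)\<^sup>2"
    using assms Suc by (intro add_mono mult_mono power_le_one) auto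
  also have "\<dots> = ((real n)\<^sup>2 + real n) * (a - b)\<^sup>2" by (simp add: distrib_right)
  also have "\<dots> \<le> (real (Suc n))\<^sup>2 * (a - b)\<^sup>2"
  proof (rule mult_right_mono)
    show "(real n)\<^sup>2 + real n \<le> (real (Suc n))\<^sup>2" by (simp add: power2_eq_square algebra_simps)
  qed simp
  finally show ?case .
qed

text \<open>The linear form whose \<open>m\<close>-th power approximates \<open>\<Phi>\<close> near the line \<open>L_line l\<close>; on that line it equals \<open>x\<^sub>1\<close>.\<close>

definition ell :: "real \<Rightarrow> real \<Rightarrow> real \<Rightarrow> real \<Rightarrow> real" where
  "ell l \<beta> a b = a + \<beta> * (b - l * a)"

lemma ell_diff_scale: "ell l \<beta> (a - t * a') (b - t * b') = ell l \<beta> a b - t * ell l \<beta> a' b'"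
  by (simp add: ell_def algebra_simps)

text \<open>The expansion of \<open>\<Phi>\<close> along \<open>x\<^sub>1 = 1\<close> is the one that \<open>hessian_order_eq_contact_order\<close> provides, with
  \<open>M = \<omega> l + 2\<close>.\<close>

locale degenerate_direction = bounded_sector_patch +
  fixes \<beta> \<phi> :: real and r :: "real poly" and M :: nat
  assumes \<phi>: "\<phi> \<noteq> 0" and M: "1 \<le> M" "M \<le> m"
    and normal_form: "\<And>u. \<Phi> (vector [1, l + u]) = \<phi> * (1 + \<beta> * u) ^ m + u ^ M * poly r u"
    and c: "c = 0"
begin

text \<open>Homogeneity turns the contact of order \<open>M\<close> on \<open>x\<^sub>1 = 1\<close> into contact of order \<open>M\<close> along the line: near \<open>(\<sigma>, \<sigma> l)\<close>
  the surface is within \<open>K |s|^M\<close>, \<open>s = x\<^sub>2 - l x\<^sub>1\<close>, of a cylinder over the planar curve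
  \<open>w \<mapsto> \<phi> w^m\<close>.\<close>

lemma cylinder_approximation:
  obtains \<sigma> \<eta> K where "0 < \<sigma>" "0 < \<eta>" "\<sigma> + \<eta> \<le> 1" "0 \<le> K"
    "\<And>z. \<bar>ell l \<beta> (z$1) (z$2) - \<sigma>\<bar> \<le> \<eta> \<Longrightarrow> \<bar>z$2 - l * z$1\<bar> \<le> \<eta> \<Longrightarrow>
       z \<in> D \<and> \<bar>\<Phi> z - \<phi> * ell l \<beta> (z$1) (z$2) ^ m\<bar> \<le> K * \<bar>z$2 - l * z$1\<bar> ^ M"
proof -
  obtain \<eta>0 \<sigma> where \<eta>0: "0 < \<eta>0" "\<eta>0 \<le> 1 / 2" and \<sigma>: "0 < \<sigma>" "\<sigma> \<le> 1 / 2"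
    and sub: "\<And>\<rho> x. 0 < \<rho> \<Longrightarrow> \<rho> \<le> \<sigma> \<Longrightarrow> \<bar>x$1 - \<rho>\<bar> \<le> \<rho> * \<eta>0 \<Longrightarrow> \<bar>x$2 - \<rho> * l\<bar> \<le> \<rho> * \<eta>0 \<Longrightarrow> x \<in> D"
    using square_subset_D by metis
  define \<eta> where "\<eta> = \<sigma> * \<eta>0 / ((1 + \<bar>l\<bar>) * (1 + \<bar>\<beta>\<bar>))"
  have pos: "0 < (1 + \<bar>l\<bar>) * (1 + \<bar>\<beta>\<bar>)" by (intro mult_pos_pos) auto
  have \<eta>: "0 < \<eta>" "\<eta> * ((1 + \<bar>l\<bar>) * (1 + \<bar>\<beta>\<bar>)) = \<sigma> * \<eta>0"
    using pos \<sigma> \<eta>0 unfolding \<eta>_def by (simp, subst nonzero_eq_divide_eq[symmetric]) auto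
  have \<eta>\<beta>: "\<eta> * (1 + \<bar>\<beta>\<bar>) + \<bar>l\<bar> * (\<eta> * (1 + \<bar>\<beta>\<bar>)) = \<sigma> * \<eta>0"
    using \<eta>(2) by (simp add: algebra_simps)
  have nn: "0 \<le> \<bar>l\<bar> * (\<eta> * (1 + \<bar>\<beta>\<bar>))" "0 \<le> \<eta> * \<bar>\<beta>\<bar>" using \<eta>(1) by auto
  have \<eta>1: "\<eta> + \<eta> * \<bar>\<beta>\<bar> + \<bar>l\<bar> * (\<eta> * (1 + \<bar>\<beta>\<bar>)) = \<sigma> * \<eta>0" using \<eta>\<beta> by (simp add: algebra_simps)
  have "\<sigma> * \<eta>0 \<le> \<sigma> * (1 / 2)" using \<eta>0 \<sigma> by (intro mult_left_mono) auto
  then have \<sigma>\<eta>: "\<sigma> * \<eta>0 \<le> \<sigma> / 2" by simp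
  have "bounded (poly r ` {- 1..1})"
    by (intro compact_imp_bounded compact_continuous_image continuous_intros) auto
  then obtain K where K: "\<forall>u\<in>{- 1..1}. \<bar>poly r u\<bar> \<le> K" unfolding bounded_iff by auto
  have K0: "0 \<le> K" using K[rule_format, of 0] by auto
  show thesis
  proof (rule that)
    show "0 < \<sigma>" "0 < \<eta>" "0 \<le> K" by fact+
    show "\<sigma> + \<eta> \<le> 1" using \<eta>1 nn \<sigma>\<eta> \<sigma> by linarith
    fix z :: "real^2"
    define w where "w = ell l \<beta> (z$1) (z$2)"
    define s where "s = z$2 - l * z$1"
    assume "\<bar>ell l \<beta> (z$1) (z$2) - \<sigma>\<bar> \<le> \<eta>" "\<bar>z$2 - l * z$1\<bar> \<le> \<eta>"
    then have w: "\<bar>w - \<sigma>\<bar> \<le> \<eta>" and s: "\<bar>s\<bar> \<le> \<eta>" by (simp_all add: w_def s_def)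
    have z1: "z$1 = w - \<beta> * s" by (simp add: w_def s_def ell_def)
    have z2: "z$2 = s + l * z$1" by (simp add: s_def)
    have "\<bar>\<beta> * s\<bar> \<le> \<eta> * \<bar>\<beta>\<bar>"
      unfolding abs_mult mult.commute[of "\<bar>\<beta>\<bar>"] using s by (rule mult_right_mono) simp
    then have d1: "\<bar>z$1 - \<sigma>\<bar> \<le> \<eta> + \<eta> * \<bar>\<beta>\<bar>" using w z1 by linarith
    then have d1': "\<bar>z$1 - \<sigma>\<bar> \<le> \<sigma> * \<eta>0" using \<eta>1 nn by linarith
    have "\<bar>l * (z$1 - \<sigma>)\<bar> \<le> \<bar>l\<bar> * (\<eta> * (1 + \<bar>\<beta>\<bar>))"
      unfolding abs_mult using d1 by (intro mult_left_mono) (auto simp: algebra_simps)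
    moreover have "z$2 - \<sigma> * l = s + l * (z$1 - \<sigma>)" by (simp add: z2 algebra_simps)
    ultimately have "\<bar>z$2 - \<sigma> * l\<bar> \<le> \<sigma> * \<eta>0" using s \<eta>1 nn by linarith
    then have zD: "z \<in> D" using sub[of \<sigma> z] d1' \<sigma> by auto
    have z1b: "\<sigma> / 2 \<le> z$1" "z$1 \<le> 1" using d1' \<sigma>\<eta> \<sigma> by linarith+
    then have z1p: "0 < z$1" using \<sigma> by linarith
    define u where "u = s / z$1"
    have u: "s = z$1 * u" using z1p by (simp add: u_def)
    have "\<bar>s\<bar> \<le> z$1" using s \<eta>1 nn \<sigma>\<eta> z1b by linarith
    then have "\<bar>u\<bar> \<le> 1" using z1p by (simp add: u_def abs_divide)
    then have ru: "\<bar>poly r u\<bar> \<le> K" using K by (auto simp: abs_le_iff)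
    have "z = z$1 *\<^sub>R vector [1, l + u]"
      using z1p by (simp add: vec_eq_iff forall_2 z2 u algebra_simps)
    then have "\<Phi> z = (z$1) ^ m * (\<phi> * (1 + \<beta> * u) ^ m + u ^ M * poly r u)"
      using homogeneous_poly_scaleR[OF hom] normal_form by metis
    also have "\<dots> = \<phi> * (z$1 * (1 + \<beta> * u)) ^ m + (z$1) ^ m * u ^ M * poly r u"
      unfolding power_mult_distrib by (simp add: distrib_left mult_ac)
    also have "z$1 * (1 + \<beta> * u) = z$1 + \<beta> * s" by (simp add: u distrib_left mult_ac)
    also have "\<dots> = w" using z1 by linarith
    also have "(z$1) ^ m = (z$1) ^ (m - M) * (z$1) ^ M" using M by (simp flip: power_add)
    also have "(z$1) ^ (m - M) * (z$1) ^ M * u ^ M * poly r u = (z$1) ^ (m - M) * (s ^ M * poly r u)"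
      by (simp add: u power_mult_distrib mult_ac)
    finally have "\<bar>\<Phi> z - \<phi> * w ^ m\<bar> = (z$1) ^ (m - M) * (\<bar>s\<bar> ^ M * \<bar>poly r u\<bar>)"
      using z1p by (simp add: abs_mult power_abs)
    also have "\<dots> \<le> 1 * (\<bar>s\<bar> ^ M * K)"
      using z1p z1b ru by (intro mult_mono power_le_one) auto
    finally show "z \<in> D \<and> \<bar>\<Phi> z - \<phi> * ell l \<beta> (z$1) (z$2) ^ m\<bar> \<le> K * \<bar>z$2 - l * z$1\<bar> ^ M"
      using zD by (simp add: w_def s_def mult_ac)
  qed
qed

text \<open>Since \<open>m \<ge> 2\<close>, the dilates of the curve \<open>w \<mapsto> \<phi> w^m\<close> sweep out an open set of the plane: the point
  \<open>(a, h)\<close> lies on the \<open>t\<close>-dilate exactly if \<open>t^(m-1) = \<phi> a^m / h\<close>, which depends continuously on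
  \<open>(a, h)\<close>. The centre corresponds to \<open>t = 3/2\<close>, \<open>w = \<sigma>\<close>.\<close>

lemma cone_coordinates:
  assumes \<sigma>: "0 < \<sigma>" and \<eta>: "0 < \<eta>"
  obtains d where "0 < d" "\<And>a h. \<bar>a - 3 / 2 * \<sigma>\<bar> \<le> d \<Longrightarrow> \<bar>h - 3 / 2 * \<phi> * \<sigma> ^ m\<bar> \<le> d \<Longrightarrow>
    \<exists>t\<in>{1..2}. \<bar>a / t - \<sigma>\<bar> \<le> \<eta> \<and> h = t * (\<phi> * (a / t) ^ m)"
proof -
  obtain n where n: "m = Suc (Suc n)" using m by (metis add_2_eq_Suc le_Suc_ex)
  define T where "T = (\<lambda>v. (\<phi> * fst v ^ m / snd v) powr (1 / real (Suc n)))"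
  define v0 where "v0 = (3 / 2 * \<sigma>, 3 / 2 * \<phi> * \<sigma> ^ m)"
  have q0: "\<phi> * fst v0 ^ m / snd v0 = (3 / 2) ^ Suc n"
  proof -
    have "fst v0 ^ m = (3 / 2) ^ m * \<sigma> ^ m" unfolding v0_def fst_conv by (rule power_mult_distrib)
    then show ?thesis using \<sigma> \<phi> by (simp add: v0_def n)
  qed
  have "T v0 = (3 / 2) powr (real (Suc n) * (1 / real (Suc n)))"
    unfolding T_def q0 by (simp only: powr_powr flip: powr_realpow[of "3/2"])
  then have T0: "T v0 = 3 / 2" by simp
  have sn: "snd v0 \<noteq> 0" using \<sigma> \<phi> by (simp add: v0_def)
  have cq: "((\<lambda>v. \<phi> * fst v ^ m / snd v) \<longlongrightarrow> (3 / 2) ^ Suc n) (nhds v0)"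
    unfolding q0[symmetric] using sn by (intro tendsto_intros filterlim_ident)
  have cT: "(T \<longlongrightarrow> 3 / 2) (nhds v0)"
  proof -
    have "(T \<longlongrightarrow> ((3 / 2) ^ Suc n) powr (1 / real (Suc n))) (nhds v0)"
      unfolding T_def by (rule tendsto_powr[OF cq tendsto_const]) simp
    then show ?thesis using T0 unfolding T_def q0 by (simp only:)
  qed
  have ca: "((\<lambda>v. fst v / T v) \<longlongrightarrow> \<sigma>) (nhds v0)"
  proof -
    have "((\<lambda>v. fst v / T v) \<longlongrightarrow> fst v0 / (3 / 2)) (nhds v0)"
      by (rule tendsto_divide[OF tendsto_fst[OF filterlim_ident] cT]) simp
    then show ?thesis by (simp add: v0_def)
  qed
  have "eventually (\<lambda>v. 0 < \<phi> * fst v ^ m / snd v) (nhds v0)"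
    by (rule order_tendstoD(1)[OF cq]) simp
  moreover have "eventually (\<lambda>v. 1 < T v) (nhds v0)" "eventually (\<lambda>v. T v < 2) (nhds v0)"
    by (rule order_tendstoD[OF cT]; simp)+
  moreover have "eventually (\<lambda>v. dist (fst v / T v) \<sigma> < \<eta>) (nhds v0)"
    using ca \<eta> by (rule tendstoD)
  ultimately have "eventually (\<lambda>v. 0 < \<phi> * fst v ^ m / snd v \<and> 1 < T v \<and> T v < 2 \<and> dist (fst v / T v) \<sigma> < \<eta>) (nhds v0)"
    by eventually_elim auto
  then obtain d where d: "0 < d" "\<And>v. dist v v0 < d \<Longrightarrow>
      0 < \<phi> * fst v ^ m / snd v \<and> 1 < T v \<and> T v < 2 \<and> dist (fst v / T v) \<sigma> < \<eta>"
    unfolding eventually_nhds_metric by blast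
  show thesis
  proof (rule that)
    show "0 < d / 3" using d by simp
    fix a h assume a: "\<bar>a - 3 / 2 * \<sigma>\<bar> \<le> d / 3" and h: "\<bar>h - 3 / 2 * \<phi> * \<sigma> ^ m\<bar> \<le> d / 3"
    have "dist (a, h) v0 \<le> \<bar>a - 3 / 2 * \<sigma>\<bar> + \<bar>h - 3 / 2 * \<phi> * \<sigma> ^ m\<bar>"
      unfolding v0_def dist_Pair_Pair dist_real_def by (rule sqrt_sum_squares_le_sum_abs[THEN order_trans]) simp
    then have "dist (a, h) v0 < d" using a h d(1) by linarith
    from d(2)[OF this] have q: "0 < \<phi> * a ^ m / h" and T: "1 < T (a, h)" "T (a, h) < 2" "\<bar>a / T (a, h) - \<sigma>\<bar> < \<eta>"
      by (auto simp: dist_real_def)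
    define t where "t = T (a, h)"
    have "t ^ Suc n = t powr real (Suc n)" using T by (subst powr_realpow) (auto simp: t_def)
    also have "\<dots> = \<phi> * a ^ m / h"
    proof -
      have "(z powr (1 / real (Suc n))) powr real (Suc n) = z" if "0 < z" for z :: real
        using that by (simp add: powr_powr)
      from this[OF q] show ?thesis by (simp add: t_def T_def)
    qed
    finally have tn: "t ^ Suc n = \<phi> * a ^ m / h" .
    have h0: "h \<noteq> 0" using q by auto
    have t0: "0 < t" using T by (simp add: t_def)
    have "h * t ^ Suc n = \<phi> * a ^ m" using tn h0 by simp
    then have "h = \<phi> * a ^ m / t ^ Suc n" using t0 by (simp add: field_simps)
    also have "\<dots> = t * (\<phi> * (a / t) ^ m)"
      using t0 by (simp add: n power_divide)
    finally have "h = t * (\<phi> * (a / t) ^ m)" .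
    then show "\<exists>t\<in>{1..2}. \<bar>a / t - \<sigma>\<bar> \<le> \<eta> \<and> h = t * (\<phi> * (a / t) ^ m)"
      using T by (intro bexI[of _ t]) (auto simp: t_def)
  qed
qed

text \<open>A \<open>\<rho>\<close>-strip around the line is flat to order \<open>\<rho>^M\<close> in the direction of \<open>x\<^sub>2 - l x\<^sub>1\<close>. Therefore \<open>F\<close> is taken to be
  a tube of fixed length in that direction and of thickness \<open>\<rho>^M\<close> in the other two. By \<open>cone_coordinates\<close>
  each point of a fixed open set \<open>E\<close> lies on a dilate of the cylinder, and then a piece of the surface of
  dimensions \<open>\<rho>^M\<close>, \<open>\<rho>\<close> is carried into \<open>F\<close>.\<close>

lemma test_strip: "2 * real M * inv_p \<le> real M + 1"
proof -
  obtain \<sigma> \<eta> K where \<sigma>: "0 < \<sigma>" "0 < \<eta>" "\<sigma> + \<eta> \<le> 1" "0 \<le> K"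
    and app: "\<And>z. \<bar>ell l \<beta> (z$1) (z$2) - \<sigma>\<bar> \<le> \<eta> \<Longrightarrow> \<bar>z$2 - l * z$1\<bar> \<le> \<eta> \<Longrightarrow>
       z \<in> D \<and> \<bar>\<Phi> z - \<phi> * ell l \<beta> (z$1) (z$2) ^ m\<bar> \<le> K * \<bar>z$2 - l * z$1\<bar> ^ M"
    by (rule cylinder_approximation) blast
  obtain d where d: "0 < d" and coord: "\<And>a h. \<bar>a - 3 / 2 * \<sigma>\<bar> \<le> d \<Longrightarrow> \<bar>h - 3 / 2 * \<phi> * \<sigma> ^ m\<bar> \<le> d \<Longrightarrow>
    \<exists>t\<in>{1..2}. \<bar>a / t - \<sigma>\<bar> \<le> \<eta> / 2 \<and> h = t * (\<phi> * (a / t) ^ m)"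
    using cone_coordinates[of \<sigma> "\<eta> / 2"] \<sigma> by auto
  define K' where "K' = 2 * (\<bar>\<phi>\<bar> * real m + K) + 1"
  have K': "0 < K'" using \<sigma>(4) by (simp add: K'_def add_nonneg_pos)
  have "real (2 * M) * inv_p \<le> real (M + 1) + real 0 * inv_q"
  proof (rule test)
    show "0 < (4::real)" "0 < 8 * d\<^sup>2" "0 < 48 * K'" "0 < min (1/2) (\<eta> / 2)" using d K' \<sigma> by auto
    fix \<rho> :: real assume "0 < \<rho>" "\<rho> < min (1/2) (\<eta> / 2)"
    then have \<rho>: "0 < \<rho>" "\<rho> \<le> 1" "\<rho> \<le> \<eta> / 2" by auto
    have \<rho>M: "0 < \<rho> ^ M" "\<rho> ^ M \<le> \<rho>"
      using \<rho> M power_decreasing[of 1 M \<rho>] by auto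
    let ?E = "{v :: real^3. \<bar>ell l \<beta> (v$1) (v$2) - 3 / 2 * \<sigma>\<bar> \<le> d \<and> \<bar>v$2 - l * v$1\<bar> \<le> 1 \<and>
       \<bar>v$3 - 3 / 2 * \<phi> * \<sigma> ^ m\<bar> \<le> d}"
    let ?F = "{v :: real^3. \<bar>ell l \<beta> (v$1) (v$2)\<bar> \<le> 2 * \<rho> ^ M \<and> \<bar>v$2 - l * v$1\<bar> \<le> 3 \<and>
       \<bar>v$3\<bar> \<le> K' * \<rho> ^ M}"
    let ?B = "\<lambda>w. {z :: real^2. \<bar>ell l \<beta> (z$1) (z$2) - w\<bar> \<le> \<rho> ^ M \<and> \<bar>z$2 - l * z$1\<bar> \<le> \<rho>}"
    have E: "?E \<in> sets borel" "emeasure lborel ?E = ennreal (8 * d\<^sup>2 * \<rho> ^ 0)"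
      using emeasure_skew_box_3[of d 1 d 1 1 0 0 \<beta> l "3 / 2 * \<sigma>" 0 "3 / 2 * \<phi> * \<sigma> ^ m"] d
      by (simp_all add: ell_def power2_eq_square mult.assoc)
    have \<rho>2M: "\<rho> ^ (2 * M) = \<rho> ^ M * \<rho> ^ M" by (simp add: mult_2 power_add)
    have F: "?F \<in> sets borel" "emeasure lborel ?F = ennreal (48 * K' * \<rho> ^ (2 * M))"
      unfolding \<rho>2M
      using emeasure_skew_box_3[of "2 * \<rho> ^ M" 3 "K' * \<rho> ^ M" 1 1 0 0 \<beta> l 0 0 0] \<rho>M K'
      by (simp_all add: ell_def mult_ac)
    have B: "?B w \<in> sets borel" "emeasure lborel (?B w) = ennreal (4 * \<rho> ^ (M + 1))" for w
      using emeasure_skew_box_2[of "\<rho> ^ M" \<rho> \<beta> l w 0] \<rho>M \<rho> by (simp_all add: ell_def mult_ac)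
    have "\<exists>t\<in>{1..2}. \<exists>B\<in>sets borel. B \<subseteq> D \<and> ennreal (4 * \<rho> ^ (M + 1)) \<le> emeasure lborel B \<and>
         (\<forall>z\<in>B. v - t *\<^sub>R graph_point g z \<in> ?F)" if v: "v \<in> ?E" for v
    proof -
      define a where "a = ell l \<beta> (v$1) (v$2)"
      obtain t where t: "t \<in> {1..2}" and w: "\<bar>a / t - \<sigma>\<bar> \<le> \<eta> / 2" and h: "v$3 = t * (\<phi> * (a / t) ^ m)"
        using coord[of a "v$3"] v by (auto simp: a_def)
      define w where "w = a / t"
      have aw: "a = t * w" using t by (auto simp: w_def)
      have sub: "z \<in> D \<and> v - t *\<^sub>R graph_point g z \<in> ?F" if z: "z \<in> ?B w" for z
      proof -
        define b where "b = ell l \<beta> (z$1) (z$2)"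
        define s where "s = z$2 - l * z$1"
        have bw: "\<bar>b - w\<bar> \<le> \<rho> ^ M" and s: "\<bar>s\<bar> \<le> \<rho>" using z by (auto simp: b_def s_def)
        have b\<sigma>: "\<bar>b - \<sigma>\<bar> \<le> \<eta>" using bw w \<rho>M \<rho> unfolding w_def by linarith
        then have zD: "z \<in> D" and err: "\<bar>\<Phi> z - \<phi> * b ^ m\<bar> \<le> K * \<bar>s\<bar> ^ M"
          using app[of z] s \<rho> \<sigma> by (auto simp: b_def s_def)
        have "\<bar>b\<bar> \<le> 1" "\<bar>w\<bar> \<le> 1" using b\<sigma> w \<sigma> unfolding w_def by linarith+
        then have "\<bar>w ^ m - b ^ m\<bar> \<le> real m * \<bar>w - b\<bar>"
          using norm_power_diff[of w b m] by simp
        also have "\<dots> \<le> real m * \<rho> ^ M" using bw by (intro mult_left_mono) auto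
        finally have "\<bar>\<phi> * w ^ m - \<phi> * b ^ m\<bar> \<le> \<bar>\<phi>\<bar> * (real m * \<rho> ^ M)"
          by (simp add: abs_mult mult_left_mono flip: right_diff_distrib)
        moreover have "K * \<bar>s\<bar> ^ M \<le> K * \<rho> ^ M"
          using s \<sigma>(4) by (intro mult_left_mono power_mono) auto
        ultimately have "\<bar>\<phi> * w ^ m - \<Phi> z\<bar> \<le> \<bar>\<phi>\<bar> * (real m * \<rho> ^ M) + K * \<rho> ^ M"
          using err by linarith
        then have "\<bar>t\<bar> * \<bar>\<phi> * w ^ m - \<Phi> z\<bar> \<le> 2 * (\<bar>\<phi>\<bar> * (real m * \<rho> ^ M) + K * \<rho> ^ M)"
          using t by (intro mult_mono) auto
        also have "\<dots> \<le> K' * \<rho> ^ M" using \<rho>M by (simp add: K'_def algebra_simps)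
        finally have 3: "\<bar>v$3 - t * g z\<bar> \<le> K' * \<rho> ^ M"
          by (simp add: h w_def c abs_mult flip: right_diff_distrib)
        have "\<bar>t\<bar> * \<bar>w - b\<bar> \<le> 2 * \<rho> ^ M" using t bw by (intro mult_mono) auto
        then have 1: "\<bar>ell l \<beta> (v$1 - t * z$1) (v$2 - t * z$2)\<bar> \<le> 2 * \<rho> ^ M"
          unfolding ell_diff_scale a_def[symmetric] b_def[symmetric] aw
          by (simp add: abs_mult flip: right_diff_distrib)
        have "\<bar>t\<bar> * \<bar>s\<bar> \<le> 2 * 1" using t s \<rho> by (intro mult_mono) auto
        then have "\<bar>t * s\<bar> \<le> 2" by (simp add: abs_mult)
        moreover have "\<bar>v$2 - l * v$1\<bar> \<le> 1" using v by simp
        moreover have "v$2 - t * z$2 - l * (v$1 - t * z$1) = v$2 - l * v$1 - t * s"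
          by (simp add: s_def algebra_simps)
        ultimately have 2: "\<bar>v$2 - t * z$2 - l * (v$1 - t * z$1)\<bar> \<le> 3" by linarith
        show ?thesis using zD 1 2 3 by simp
      qed
      show ?thesis
        using t B[of w] sub by (intro bexI[of _ t] bexI[of _ "?B w"] conjI) auto
    qed
    then show "\<exists>E F. E \<in> sets borel \<and> F \<in> sets borel \<and>
      ennreal (8 * d\<^sup>2 * \<rho> ^ 0) \<le> emeasure lborel E \<and> emeasure lborel F \<le> ennreal (48 * K' * \<rho> ^ (2 * M)) \<and>
      (\<forall>y\<in>E. \<exists>t\<in>{1..2}. \<exists>B\<in>sets borel. B \<subseteq> D \<and> ennreal (4 * \<rho> ^ (M + 1)) \<le> emeasure lborel B \<and>
         (\<forall>x\<in>B. y - t *\<^sub>R graph_point g x \<in> F))"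
      using E F by (intro exI[of _ ?E] exI[of _ ?F] conjI ballI) simp_all
  qed
  then show ?thesis by (simp add: algebra_simps)
qed

text \<open>The Knapp example. A cap of dimensions \<open>\<rho>^M\<close>, \<open>\<rho>^2\<close> around a point \<open>X\<^sub>0\<close> of the surface above the line lies
  within \<open>\<rho>^(2M)\<close> of its tangent plane \<open>nu v = nu X\<^sub>0\<close>: the second-order term of \<open>w^m\<close> and the error of
  the cylinder approximation have this same size. The position vector \<open>X\<^sub>0\<close> is transversal to the tangent
  plane, as \<open>m \<ge> 2\<close>; so with \<open>t = nu v / nu X\<^sub>0\<close> the cap can follow a segment in direction \<open>X\<^sub>0\<close> of fixed
  length, and \<open>E\<close> is a neighbourhood of this segment of measure \<open>\<rho>^(M+2)\<close>.\<close>

lemma test_knapp: "real (3 * M + 2) * inv_p \<le> real (M + 2) + real (M + 2) * inv_q"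
proof -
  obtain \<sigma> \<eta> K where \<sigma>: "0 < \<sigma>" "0 < \<eta>" "\<sigma> + \<eta> \<le> 1" "0 \<le> K"
    and app: "\<And>z. \<bar>ell l \<beta> (z$1) (z$2) - \<sigma>\<bar> \<le> \<eta> \<Longrightarrow> \<bar>z$2 - l * z$1\<bar> \<le> \<eta> \<Longrightarrow>
       z \<in> D \<and> \<bar>\<Phi> z - \<phi> * ell l \<beta> (z$1) (z$2) ^ m\<bar> \<le> K * \<bar>z$2 - l * z$1\<bar> ^ M"
    by (rule cylinder_approximation) blast
  define \<kappa> where "\<kappa> = \<phi> * (real m * \<sigma> ^ (m - 1))"
  \<comment> \<open>\<open>n0\<close> is the value of \<open>nu\<close> at the point of the surface above \<open>(\<sigma>, \<sigma> l)\<close>\<close>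
  define n0 where "n0 = \<phi> * \<sigma> ^ m - \<kappa> * \<sigma>"
  define nu where "nu = (\<lambda>v :: real^3. v$3 - \<kappa> * ell l \<beta> (v$1) (v$2))"
  have "\<sigma> ^ (m - 1) * \<sigma> = \<sigma> ^ m" using m by (simp flip: power_Suc2)
  then have "n0 = \<phi> * \<sigma> ^ m * (1 - real m)" by (simp add: n0_def \<kappa>_def algebra_simps)
  then have n0: "n0 \<noteq> 0" using \<phi> \<sigma> m by auto
  define K' where "K' = 2 * (\<bar>\<phi>\<bar> * (real m)\<^sup>2 + K) + 1"
  have K': "0 < K'" using \<sigma>(4) by (simp add: K'_def add_nonneg_pos)
  show ?thesis
  proof (rule test)
    show "0 < (4::real)" "0 < 4 * \<bar>n0\<bar>" "0 < 72 * K'" "0 < min 1 \<eta>" using n0 K' \<sigma> by auto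
    fix \<rho> :: real assume "0 < \<rho>" "\<rho> < min 1 \<eta>"
    then have \<rho>: "0 < \<rho>" "\<rho> \<le> 1" "\<rho> \<le> \<eta>" by auto
    have \<rho>M: "0 < \<rho> ^ M" "\<rho> ^ M \<le> \<rho>" "\<rho> ^ 2 \<le> \<rho>"
      using \<rho> M power_decreasing[of 1 M \<rho>] power_decreasing[of 1 2 \<rho>] by auto
    let ?E = "{v :: real^3. \<bar>ell l \<beta> (v$1) (v$2) - \<sigma> * (nu v / n0)\<bar> \<le> \<rho> ^ M \<and> \<bar>v$2 - l * v$1\<bar> \<le> \<rho> ^ 2 \<and>
       \<bar>nu v / n0 - 3 / 2\<bar> \<le> 1 / 2}"
    let ?F = "{v :: real^3. \<bar>ell l \<beta> (v$1) (v$2)\<bar> \<le> 3 * \<rho> ^ M \<and> \<bar>v$2 - l * v$1\<bar> \<le> 3 * \<rho> ^ 2 \<and>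
       \<bar>nu v\<bar> \<le> K' * \<rho> ^ (2 * M)}"
    let ?B = "{z :: real^2. \<bar>ell l \<beta> (z$1) (z$2) - \<sigma>\<bar> \<le> \<rho> ^ M \<and> \<bar>z$2 - l * z$1\<bar> \<le> \<rho> ^ 2}"
    have split2: "\<rho> ^ (M + 2) = \<rho> ^ M * \<rho> ^ 2" by (rule power_add)
    have E: "?E \<in> sets borel \<and> emeasure lborel ?E = ennreal (4 * \<bar>n0\<bar> * \<rho> ^ (M + 2))"
    proof -
      have det: "(1 + \<sigma> * \<kappa> / n0) * (1 / n0) - (- \<sigma> / n0) * (- \<kappa> / n0) = 1 / n0"
        using n0 by (simp add: field_simps)
      have eq: "?E = {v. \<bar>(1 + \<sigma> * \<kappa> / n0) * (v$1 + \<beta> * (v$2 - l * v$1)) + (- \<sigma> / n0) * v$3 - 0\<bar> \<le> \<rho> ^ M \<and>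
          \<bar>v$2 - l * v$1 - 0\<bar> \<le> \<rho> ^ 2 \<and>
          \<bar>(- \<kappa> / n0) * (v$1 + \<beta> * (v$2 - l * v$1)) + (1 / n0) * v$3 - 3 / 2\<bar> \<le> 1 / 2}"
      proof -
        have "a - \<sigma> * ((h - \<kappa> * a) / n0) = (1 + \<sigma> * \<kappa> / n0) * a + (- \<sigma> / n0) * h - 0"
          "(h - \<kappa> * a) / n0 - 3 / 2 = (- \<kappa> / n0) * a + (1 / n0) * h - 3 / 2" for a h
          by (simp_all add: diff_divide_distrib algebra_simps)
        then show ?thesis unfolding nu_def ell_def by (simp only: diff_0_right)
      qed
      show ?thesis unfolding eq split2
        using emeasure_skew_box_3[of "\<rho> ^ M" "\<rho> ^ 2" "1 / 2" "1 + \<sigma> * \<kappa> / n0" "1 / n0" "- \<sigma> / n0" "- \<kappa> / n0"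
            \<beta> l 0 0 "3 / 2", unfolded det] n0 \<rho>
        by (simp add: abs_divide mult_ac)
    qed
    have F: "?F \<in> sets borel \<and> emeasure lborel ?F = ennreal (72 * K' * \<rho> ^ (3 * M + 2))"
    proof -
      have split: "\<rho> ^ (3 * M + 2) = \<rho> ^ M * \<rho> ^ 2 * \<rho> ^ (2 * M)" by (simp flip: power_add)
      show ?thesis unfolding split
        using emeasure_skew_box_3[of "3 * \<rho> ^ M" "3 * \<rho> ^ 2" "K' * \<rho> ^ (2 * M)" 1 1 0 "- \<kappa>" \<beta> l 0 0 0] K' \<rho>
        by (simp add: ell_def nu_def add.commute mult_ac)
    qed
    have B: "?B \<in> sets borel" "emeasure lborel ?B = ennreal (4 * \<rho> ^ (M + 2))"
      unfolding split2 using emeasure_skew_box_2[of "\<rho> ^ M" "\<rho> ^ 2" \<beta> l \<sigma> 0] \<rho>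
      by (simp_all add: ell_def mult_ac)
    have BD: "z \<in> D \<and> \<bar>\<Phi> z - \<kappa> * ell l \<beta> (z$1) (z$2) - n0\<bar> \<le> (\<bar>\<phi>\<bar> * (real m)\<^sup>2 + K) * \<rho> ^ (2 * M)"
      if z: "z \<in> ?B" for z
    proof -
      define b where "b = ell l \<beta> (z$1) (z$2)"
      define s where "s = z$2 - l * z$1"
      have b: "\<bar>b - \<sigma>\<bar> \<le> \<rho> ^ M" and s: "\<bar>s\<bar> \<le> \<rho> ^ 2" using z by (auto simp: b_def s_def)
      have b\<eta>: "\<bar>b - \<sigma>\<bar> \<le> \<eta>" and s\<eta>: "\<bar>s\<bar> \<le> \<eta>" using b s \<rho>M \<rho> by linarith+
      then have zD: "z \<in> D" and err: "\<bar>\<Phi> z - \<phi> * b ^ m\<bar> \<le> K * \<bar>s\<bar> ^ M"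
        using app[of z] by (auto simp: b_def s_def)
      have "\<bar>s\<bar> ^ M \<le> (\<rho> ^ 2) ^ M" using s by (intro power_mono) auto
      then have "K * \<bar>s\<bar> ^ M \<le> K * \<rho> ^ (2 * M)" using \<sigma>(4) by (simp add: power_mult mult_left_mono)
      moreover have "\<bar>\<phi> * (b ^ m - \<sigma> ^ m - real m * \<sigma> ^ (m - 1) * (b - \<sigma>))\<bar> \<le> \<bar>\<phi>\<bar> * ((real m)\<^sup>2 * \<rho> ^ (2 * M))"
      proof -
        have "\<bar>b\<bar> \<le> 1" "\<bar>\<sigma>\<bar> \<le> 1" using b\<eta> \<sigma> by linarith+
        then have "\<bar>b ^ m - \<sigma> ^ m - real m * \<sigma> ^ (m - 1) * (b - \<sigma>)\<bar> \<le> (real m)\<^sup>2 * (b - \<sigma>)\<^sup>2"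
          by (rule power_taylor2_le)
        also have "(b - \<sigma>)\<^sup>2 \<le> (\<rho> ^ M)\<^sup>2" using b by (metis abs_ge_zero power2_abs power_mono)
        also have "(\<rho> ^ M)\<^sup>2 = \<rho> ^ (2 * M)" by (simp add: power_mult[symmetric] mult.commute)
        finally show ?thesis by (simp add: abs_mult mult_left_mono)
      qed
      moreover have "\<phi> * (b ^ m - \<sigma> ^ m - real m * \<sigma> ^ (m - 1) * (b - \<sigma>)) = \<phi> * b ^ m - \<kappa> * b - n0"
        by (simp add: n0_def \<kappa>_def algebra_simps)
      ultimately have "\<bar>\<Phi> z - \<kappa> * b - n0\<bar> \<le> \<bar>\<phi>\<bar> * ((real m)\<^sup>2 * \<rho> ^ (2 * M)) + K * \<rho> ^ (2 * M)"
        using err by linarith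
      then show ?thesis using zD by (simp add: b_def algebra_simps)
    qed
    have mem: "v - (nu v / n0) *\<^sub>R graph_point g z \<in> ?F" and t12: "nu v / n0 \<in> {1..2}"
      if v: "v \<in> ?E" and z: "z \<in> ?B" for v z
    proof -
      define t where "t = nu v / n0"
      have "\<bar>t - 3 / 2\<bar> \<le> 1 / 2" using v by (simp add: t_def)
      then show "nu v / n0 \<in> {1..2}" unfolding t_def[symmetric] atLeastAtMost_iff by arith
      then have t: "\<bar>t\<bar> \<le> 2" by (auto simp: t_def)
      define b where "b = ell l \<beta> (z$1) (z$2)"
      define s where "s = z$2 - l * z$1"
      have b: "\<bar>b - \<sigma>\<bar> \<le> \<rho> ^ M" and s: "\<bar>s\<bar> \<le> \<rho> ^ 2" using z by (auto simp: b_def s_def)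
      have "\<bar>t * (b - \<sigma>)\<bar> \<le> 2 * \<rho> ^ M" unfolding abs_mult using t b by (intro mult_mono) auto
      moreover have "\<bar>ell l \<beta> (v$1) (v$2) - \<sigma> * t\<bar> \<le> \<rho> ^ M" using v by (simp add: t_def)
      moreover have "ell l \<beta> (v$1 - t * z$1) (v$2 - t * z$2) = (ell l \<beta> (v$1) (v$2) - \<sigma> * t) - t * (b - \<sigma>)"
        unfolding ell_diff_scale b_def by (simp add: algebra_simps)
      ultimately have 1: "\<bar>ell l \<beta> (v$1 - t * z$1) (v$2 - t * z$2)\<bar> \<le> 3 * \<rho> ^ M" by linarith
      have "\<bar>t * s\<bar> \<le> 2 * \<rho> ^ 2" unfolding abs_mult using t s by (intro mult_mono) auto
      moreover have "\<bar>v$2 - l * v$1\<bar> \<le> \<rho> ^ 2" using v by simp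
      moreover have "v$2 - t * z$2 - l * (v$1 - t * z$1) = v$2 - l * v$1 - t * s"
        by (simp add: s_def algebra_simps)
      ultimately have 2: "\<bar>v$2 - t * z$2 - l * (v$1 - t * z$1)\<bar> \<le> 3 * \<rho> ^ 2" by linarith
      have "nu (v - t *\<^sub>R graph_point g z) = nu v - t * (\<Phi> z - \<kappa> * b)"
        unfolding nu_def b_def by (simp add: ell_diff_scale c algebra_simps)
      also have "nu v = t * n0" using n0 by (simp add: t_def)
      finally have "\<bar>nu (v - t *\<^sub>R graph_point g z)\<bar> = \<bar>t\<bar> * \<bar>\<Phi> z - \<kappa> * b - n0\<bar>"
        by (simp add: abs_minus_commute flip: abs_mult right_diff_distrib)
      also have "\<dots> \<le> 2 * ((\<bar>\<phi>\<bar> * (real m)\<^sup>2 + K) * \<rho> ^ (2 * M))"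
        using BD[OF z] t by (intro mult_mono) (auto simp: b_def)
      also have "\<dots> \<le> K' * \<rho> ^ (2 * M)" using \<rho> by (simp add: K'_def algebra_simps)
      finally have 3: "\<bar>nu (v - t *\<^sub>R graph_point g z)\<bar> \<le> K' * \<rho> ^ (2 * M)" .
      show "v - (nu v / n0) *\<^sub>R graph_point g z \<in> ?F"
        using 1 2 3 unfolding t_def[symmetric] by simp
    qed
    have "\<sigma> *\<^sub>R vector [1, l] \<in> ?B" using \<rho> by (simp add: ell_def)
    then have t12': "nu v / n0 \<in> {1..2}" if "v \<in> ?E" for v using t12 that by blast
    show "\<exists>E F. E \<in> sets borel \<and> F \<in> sets borel \<and>
      ennreal (4 * \<bar>n0\<bar> * \<rho> ^ (M + 2)) \<le> emeasure lborel E \<and>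
      emeasure lborel F \<le> ennreal (72 * K' * \<rho> ^ (3 * M + 2)) \<and>
      (\<forall>y\<in>E. \<exists>t\<in>{1..2}. \<exists>B\<in>sets borel. B \<subseteq> D \<and> ennreal (4 * \<rho> ^ (M + 2)) \<le> emeasure lborel B \<and>
         (\<forall>x\<in>B. y - t *\<^sub>R graph_point g x \<in> F))"
    proof (rule exI[of _ ?E], rule exI[of _ ?F], intro conjI ballI)
      fix v assume v: "v \<in> ?E"
      show "\<exists>t\<in>{1..2}. \<exists>B\<in>sets borel. B \<subseteq> D \<and> ennreal (4 * \<rho> ^ (M + 2)) \<le> emeasure lborel B \<and>
         (\<forall>x\<in>B. v - t *\<^sub>R graph_point g x \<in> ?F)"
        using t12'[OF v] B BD mem[OF v]
        by (intro bexI[of _ "nu v / n0"] bexI[of _ ?B] conjI subsetI ballI) (blast | simp)+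
    qed (use E F in simp_all)
  qed
qed

end

section \<open>The necessary conditions\<close>

lemma type_B_conditions:
  fixes m M :: nat and x y :: real
  assumes "2 \<le> m" "3 \<le> M" "M \<le> m" "y \<le> x" "x \<le> 3 * y"
    and o: "real (m + 2) * x \<le> 2 + real (m + 2) * y"
    and s: "2 * real M * x \<le> real M + 1"
    and k: "real (3 * M + 2) * x \<le> real (M + 2) + real (M + 2) * y"
  shows "(real m / 2 + 1) * x - (real m / 2 + 1) * y - 1 \<le> 0"
    "x \<le> (real M + 1) / (2 * real M)"
    "(3 * real M + 2) / (real M + 2) * x - 1 \<le> y"
    "(real M / 2 + 1) * (x - y) \<le> 1"
proof -
  have "(real m / 2 + 1) * (x - y) = (real (m + 2) * x - real (m + 2) * y) / 2"
    by (simp add: field_simps)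
  moreover have "(A - B) / 2 \<le> 1" if "A \<le> 2 + B" for A B :: real using that by simp
  ultimately have o': "(real m / 2 + 1) * (x - y) \<le> 1" using o by metis
  then show "(real m / 2 + 1) * x - (real m / 2 + 1) * y - 1 \<le> 0"
    by (simp add: right_diff_distrib)
  have "(real M / 2 + 1) * (x - y) \<le> (real m / 2 + 1) * (x - y)"
    using assms by (intro mult_right_mono) auto
  then show "(real M / 2 + 1) * (x - y) \<le> 1" using o' by (rule order_trans)
  show "x \<le> (real M + 1) / (2 * real M)" using s assms(2) by (simp add: field_simps)
  show "(3 * real M + 2) / (real M + 2) * x - 1 \<le> y"
    using k by (simp add: field_simps)
qed

theorem theorem1p10:
  fixes m :: nat and c :: real and \<Phi> :: "real^2 \<Rightarrow> real"
    and R :: "real set" and \<alpha> :: nat and \<omega> :: "real \<Rightarrow> nat" and Q :: "real^2 \<Rightarrow> real"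
  assumes "2 \<le> m"
    and "homogeneous_poly m \<Phi>"
    and "\<exists>x. \<Phi> x \<noteq> 0"
    and "\<not> (\<exists>k a b :: real. \<forall>x. \<Phi> x = k * (a * x$1 + b * x$2) ^ m)"
    and "hessian_factorization \<Phi> R \<alpha> \<omega> Q"
  shows "\<exists>\<epsilon>0>0. \<forall>\<epsilon>. 0 < \<epsilon> \<and> \<epsilon> < \<epsilon>0 \<and> sectors_disjoint \<Phi> \<epsilon> \<longrightarrow>
    (\<exists>r>0. \<forall>U. open U \<and> 0 \<in> U \<and> U \<subseteq> ball 0 r \<longrightarrow>
      (\<forall>l\<in>R. type_B \<Phi> l \<longrightarrow>
        (\<forall>p q :: ennreal. 1 \<le> p \<and> 1 \<le> q \<and>
            Lp_Lq_bounded p q (local_maximal (sigma_measure \<Phi> c \<epsilon> U l)) \<longrightarrow>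
          (let M = real (\<omega> l + 2); x = enn2real (1 / p); y = enn2real (1 / q) in
            (c \<noteq> 0 \<longrightarrow>
               (real m / 2 + 1) * x - y - 1 \<le> 0 \<and> y \<le> x \<and> x \<le> 3 * y) \<and>
            (c = 0 \<longrightarrow>
               (real m / 2 + 1) * x - (real m / 2 + 1) * y - 1 \<le> 0 \<and>
               (M \<ge> 6 \<longrightarrow>
                  y \<le> x \<and> x \<le> 3 * y \<and> x \<le> (M + 1) / (2 * M) \<and>
                  (M / 2 + 1) * (x - y) \<le> 1) \<and>
               (M = 5 \<longrightarrow>
                  y \<le> x \<and> x \<le> 3 * y \<and> x \<le> (M + 1) / (2 * M) \<and>
                  y \<ge> (3 * M + 2) / (M + 2) * x - 1 \<and>
                  (M / 2 + 1) * (x - y) \<le> 1) \<and>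
               (M = 4 \<or> M = 3 \<longrightarrow>
                  y \<le> x \<and> x \<le> 3 * y \<and> x \<le> (M + 1) / (2 * M) \<and>
                  y \<ge> (3 * M + 2) / (M + 2) * x - 1))))))"
proof (rule exI[of _ 1], intro conjI allI impI, simp, elim conjE, rule exI[of _ "1 / 2"],
    intro conjI allI impI ballI, simp, elim conjE)
  fix \<epsilon> :: real and U :: "(real^2) set" and l :: real and p q :: ennreal
  assume \<epsilon>: "0 < \<epsilon>" and U: "open U" "0 \<in> U" "U \<subseteq> ball 0 (1 / 2)"
    and l: "l \<in> R" "type_B \<Phi> l" and p: "1 \<le> p" and q: "1 \<le> q"
    and bounded: "Lp_Lq_bounded p q (local_maximal (sigma_measure \<Phi> c \<epsilon> U l))"
  define M where "M = \<omega> l + 2"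
  define x where "x = enn2real (1 / p)"
  define y where "y = enn2real (1 / q)"
  interpret P: bounded_sector_patch m c \<Phi> \<epsilon> U l p q
    using assms(1,2) \<epsilon> U p q bounded by unfold_locales
  have P: "P.inv_p = x" "P.inv_q = y" by (simp_all add: P.inv_p_def P.inv_q_def x_def y_def)
  note yx = P.test_large_cubes[unfolded P] and xy = P.test_surface_neighbourhood[unfolded P]
  have "1 \<le> \<omega> l" using assms(5) l(1) unfolding hessian_factorization_def by blast
  then have M3: "3 \<le> M" by (simp add: M_def)
  have "(real m / 2 + 1) * x - y - 1 \<le> 0" if "c \<noteq> 0"
  proof -
    have "(real m / 2 + 1) * x - y - 1 = (real (m + 2) * x - (2 + 2 * y)) / 2"
      by (simp add: field_simps)
    also have "\<dots> \<le> 0" using P.test_origin_box_translated[OF that, unfolded P] by simp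
    finally show ?thesis .
  qed
  moreover have "(real m / 2 + 1) * x - (real m / 2 + 1) * y - 1 \<le> 0 \<and> x \<le> (real M + 1) / (2 * real M) \<and>
      (3 * real M + 2) / (real M + 2) * x - 1 \<le> y \<and> (real M / 2 + 1) * (x - y) \<le> 1" if c: "c = 0"
  proof -
    obtain \<beta> \<phi> r where nf: "\<phi> \<noteq> 0" "\<omega> l + 2 \<le> m"
      "\<And>u. \<Phi> (vector [1, l + u]) = \<phi> * (1 + \<beta> * u) ^ m + u ^ (\<omega> l + 2) * poly r u"
      using hessian_order_eq_contact_order[OF assms(1,2,5) l] by metis
    interpret Q: degenerate_direction m c \<Phi> \<epsilon> U l p q \<beta> \<phi> r M
      using nf c by unfold_locales (auto simp: M_def)
    have "M \<le> m" using nf(2) by (simp add: M_def)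
    note cond = type_B_conditions[OF assms(1) M3 this yx xy
        P.test_origin_box[OF c, unfolded P] Q.test_strip[unfolded P] Q.test_knapp[unfolded P]]
    show ?thesis by (intro conjI cond)
  qed
  ultimately show "let M = real (\<omega> l + 2); x = enn2real (1 / p); y = enn2real (1 / q) in
            (c \<noteq> 0 \<longrightarrow>
               (real m / 2 + 1) * x - y - 1 \<le> 0 \<and> y \<le> x \<and> x \<le> 3 * y) \<and>
            (c = 0 \<longrightarrow>
               (real m / 2 + 1) * x - (real m / 2 + 1) * y - 1 \<le> 0 \<and>
               (M \<ge> 6 \<longrightarrow>
                  y \<le> x \<and> x \<le> 3 * y \<and> x \<le> (M + 1) / (2 * M) \<and>
                  (M / 2 + 1) * (x - y) \<le> 1) \<and>
               (M = 5 \<longrightarrow>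
                  y \<le> x \<and> x \<le> 3 * y \<and> x \<le> (M + 1) / (2 * M) \<and>
                  y \<ge> (3 * M + 2) / (M + 2) * x - 1 \<and>
                  (M / 2 + 1) * (x - y) \<le> 1) \<and>
               (M = 4 \<or> M = 3 \<longrightarrow>
                  y \<le> x \<and> x \<le> 3 * y \<and> x \<le> (M + 1) / (2 * M) \<and>
                  y \<ge> (3 * M + 2) / (M + 2) * x - 1))"
    using yx xy unfolding Let_def M_def[symmetric] x_def[symmetric] y_def[symmetric] by (intro conjI impI) simp_all
qed

end
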